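(* Let $N,M,K\in\mathbb{N}$, let $p_1,\dots,p_K>0$ with $\sum_{k=1}^K p_k=1$, and let $\mathbf C_1,\dots,\mathbf C_K\in\mathbb{C}^{N\times N}$ be covariance matrices (Hermitian positive semidefinite). Let $\mathbf h\in\mathbb{C}^N$ have the zero-mean Gaussian mixture density $p(\mathbf h)=\sum_{k=1}^K p_k\,\mathcal{N}_{\mathbb{C}}(\mathbf h;\mathbf 0,\mathbf C_k)$, with global covariance $\mathbf C_{\mathbf h}=\sum_{k=1}^K p_k\mathbf C_k$. Let $\mathbf a\in\mathbb{C}^M$ with $\|\mathbf a\|_2^2=M$, $\mathbf A=\mathbf a\otimes \mathbf I_N\in\mathbb{C}^{NM\times N}$, and let $\mathbf n\sim\mathcal{N}_{\mathbb{C}}(\mathbf 0,\eta^2\mathbf I_{NM})$ with $\eta^2>0$ be independent of $\mathbf h$. Set $\mathbf y=\mathbf A\mathbf h+\mathbf n$ and $\mathbf r=Q(\mathbf y)$, where $Q(x)=\frac{1}{\sqrt2}(\operatorname{sign}(\operatorname{Re}x)+\mathrm{j}\operatorname{sign}(\operatorname{Im}x))$ is applied element-wise. Define $\mathbf C_{\mathbf y|k}=\mathbf A\mathbf C_k\mathbf A^{\mathrm H}+\eta^2\mathbf I$, $\mathbf C_{\mathbf y}=\sum_{k=1}^K p_k\mathbf C_{\mathbf y|k}$, and $\bar{\mathbf C}_{\mathbf y|k}=\operatorname{diag}(\mathbf C_{\mathbf y|k})^{-1/2}\mathbf C_{\mathbf y|k}\operatorname{diag}(\mathbf C_{\mathbf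 y|k})^{-1/2}$. Then the Bussgang gain $\mathbf B:=\mathbb{E}[\mathbf r\mathbf y^{\mathrm H}]\,\mathbb{E}[\mathbf y\mathbf y^{\mathrm H}]^{-1}$, the cross-covariance $\mathbf C_{\mathbf h\mathbf r}:=\mathbb{E}[\mathbf h\mathbf r^{\mathrm H}]$ and the covariance $\mathbf C_{\mathbf r}:=\mathbb{E}[\mathbf r\mathbf r^{\mathrm H}]$ are given by $$\mathbf B=\sqrt{\tfrac{2}{\pi}}\sum_{k=1}^K p_k\operatorname{diag}(\mathbf C_{\mathbf y|k})^{-1/2}\mathbf C_{\mathbf y|k}\mathbf C_{\mathbf y}^{-1},\qquad \mathbf C_{\mathbf h\mathbf r}=\sqrt{\tfrac{2}{\pi}}\sum_{k=1}^K p_k\mathbf C_k\mathbf A^{\mathrm H}\operatorname{diag}(\mathbf C_{\mathbf y|k})^{-1/2},$$ $$\mathbf C_{\mathbf r}=\frac{2}{\pi}\sum_{k=1}^K p_k\Big(\sin^{-1}\big(\operatorname{Re}(\bar{\mathbf C}_{\mathbf y|k})\big)+\mathrm{j}\,\sin^{-1}\big(\operatorname{Im}(\bar{\mathbf C}_{\mathbf y|k})\big)\Big),$$ where $\sin^{-1}$ is applied element-wise. (These are the quantities in the linear MMSE estimator $\hat{\mathbf h}=\mathbf C_{\mathbf h\mathbf r}\mathbf C_{\mathbf r}^{-1}\mathbf r$.)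
   Context: $\operatorname{diag}(\mathbf X)$ denotes the diagonal matrix with the diagonal of $\mathbf X$; $\mathcal N_{\mathbb C}(\mathbf 0,\mathbf C)$ is the circularly symmetric complex Gaussian distribution with covariance $\mathbf C$; $\otimes$ is the Kronecker product; $\mathbf n$ is the column-wise vectorization of $M$ i.i.d. noise vectors, so $\mathbf y$ is the vectorization of $\mathbf h\mathbf a^{\mathrm T}+[\mathbf n_1,\dots,\mathbf n_M]$. *)

theory Defs
  imports "HOL-Analysis.Analysis" "HOL-Probability.Probability"
begin

definition hermT :: "complex^'n^'m \<Rightarrow> complex^'m^'n" where
  "hermT A = (\<chi> i j. cnj (A $ j $ i))"

definition hermitian_psd :: "complex^'n^'n \<Rightarrow> bool" where
  "hermitian_psd C \<longleftrightarrow> hermT C = C \<and>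
     (\<forall>x::complex^'n. 0 \<le> Re (\<Sum>i\<in>UNIV. cnj (x $ i) * (C *v x) $ i))"

definition outer :: "complex^'m \<Rightarrow> complex^'n \<Rightarrow> complex^'n^'m" where
  "outer x y = (\<chi> i j. x $ i * cnj (y $ j))"

definition mexp :: "'a measure \<Rightarrow> ('a \<Rightarrow> complex^'n^'m) \<Rightarrow> complex^'n^'m" where
  "mexp P X = (\<chi> i j. integral\<^sup>L P (\<lambda>\<omega>. X \<omega> $ i $ j))"

definition std_cgauss :: "(complex^'d) measure" where
  "std_cgauss = density lborel (\<lambda>z. ennreal (\<Prod>i\<in>UNIV. exp (- (cmod (z $ i))\<^sup>2) / pi))"

text \<open>N_C(0,C): law of L z with z ~ N_C(0,I) and L L^H = C (a square root of C).
  For positive definite C this is the measure with density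
  exp(-x^H C^-1 x) / (pi^d det C).\<close>
definition cgauss :: "complex^'d^'d \<Rightarrow> (complex^'d) measure" where
  "cgauss C = distr std_cgauss borel (\<lambda>z. (SOME L::complex^'d^'d. L ** hermT L = C) *v z)"

definition Qc :: "complex \<Rightarrow> complex" where
  "Qc x = Complex (sgn (Re x)) (sgn (Im x)) / complex_of_real (sqrt 2)"

definition Qv :: "complex^'n \<Rightarrow> complex^'n" where
  "Qv x = (\<chi> i. Qc (x $ i))"

text \<open>Kronecker product a \<otimes> I_N, rows indexed by (i,m) = vec index (m-1)N+i.\<close>
definition kron_I :: "complex^'m \<Rightarrow> complex^'n^('n \<times> 'm)" where
  "kron_I a = (\<chi> r j. a $ snd r * (if fst r = j then 1 else 0))"

definition diag_isqrt :: "complex^'n^'n \<Rightarrow> complex^'n^'n" where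
  "diag_isqrt C = (\<chi> i j. if i = j then complex_of_real (1 / sqrt (Re (C $ i $ i))) else 0)"

definition carcsin_entry :: "complex^'n^'m \<Rightarrow> complex^'n^'m" where
  "carcsin_entry X = (\<chi> i j. Complex (arcsin (Re (X $ i $ j))) (arcsin (Im (X $ i $ j))))"

end

theory Submission
  imports Defs
begin

text \<open>
  Conditionally on the mixture component, \<open>(h, y)\<close> is a complex linear image of a standard Gaussian
  vector, so every entry of the three expectations is an expectation over real linear functionals
  \<open>x \<bullet> u\<close>, \<open>x \<bullet> v\<close> of one rotation invariant Gaussian vector \<open>x\<close> on a Euclidean space. Reflecting in
  the part of \<open>v\<close> orthogonal to \<open>u\<close> gives \<open>E[sgn(x \<bullet> u)(x \<bullet> v)]\<close> from \<open>E\<bar>x \<bullet> u\<bar>\<close> (Bussgang). The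
  arcsine law \<open>E[sgn(x \<bullet> u) sgn(x \<bullet> v)] = 2/pi arcsin \<rho>\<close> holds because by reflection invariance the
  left hand side depends only on the angle between \<open>u\<close> and \<open>v\<close>, and the probability of a sign change
  is additive in that angle.
\<close>

section \<open>The rotation invariant Gaussian measure\<close>

text \<open>The covariances may be singular, so a component need not have a density to integrate.
  \<open>cgauss\<close> is the image of a standard Gaussian under a root picked by
  \<open>SOME\<close>, and all that is used about that root is L L^H = C; hence a proof that every
  positive semidefinite matrix has one. The vector y is a mixture, for which Gaussian identities
  fail in general; its moments are explicit only within a component, and expectations are linear in
  the law. As the law of h is given through measures of sets, this linearity has to be lifted to
  integrals. The noise keeps every diagonal entry of the component covariances at least
  \<open>\<eta>\<^sup>2\<close>, so the normalisation is meaningful and the signs vanish only on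
  null sets. The constant \<open>sqrt (2 / pi)\<close> is 2 * (1 / sqrt 2) * (1 / sqrt pi): two
  equal sign moments, the scale of \<open>Qc\<close>, and the absolute moment of a unit functional.
  In \<open>2 / pi\<close> the two equal arcsine terms cancel the squared scale 1/2. For the
  additive function of the angle boundedness is the only regularity used, so no two-dimensional
  Gaussian integral is evaluated.\<close>

text \<open>Variance 1/2 per real coordinate, so that complex coordinates have unit variance.\<close>
definition gauss :: "'a::euclidean_space measure" where
  "gauss = density lborel (\<lambda>x. ennreal (exp (- (norm x)\<^sup>2) / sqrt pi ^ DIM('a)))"

lemma space_gauss [simp]: "space gauss = UNIV"
  and sets_gauss [measurable_cong, simp]: "sets gauss = sets borel"
  by (simp_all add: gauss_def)

lemma gauss_density_Basis:
  fixes x :: "'a::euclidean_space"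
  shows "exp (- (norm x)\<^sup>2) / sqrt pi ^ DIM('a) = (\<Prod>b\<in>Basis. exp (- (x \<bullet> b)\<^sup>2) / sqrt pi)"
  by (simp add: prod_dividef exp_sum sum_negf[symmetric] euclidean_inner[of x x] power2_norm_eq_inner
      flip: power2_eq_square)

lemma normal_density_half: "normal_density 0 (1 / sqrt 2) x = exp (- x\<^sup>2) / sqrt pi"
  by (simp add: normal_density_def power_divide)

text \<open>The density is a product over coordinates, so all coordinates except \<open>b\<close>
  integrate to 1. Working with nonnegative integrals avoids any question of integrability.\<close>

lemma nn_integral_gauss_Basis:
  fixes b :: "'a::euclidean_space" and g :: "real \<Rightarrow> ennreal"
  assumes b: "b \<in> Basis" and g [measurable]: "g \<in> borel_measurable borel"
  shows "(\<integral>\<^sup>+x. g (x \<bullet> b) \<partial>gauss) = (\<integral>\<^sup>+t. normal_density 0 (1 / sqrt 2) t * g t \<partial>lborel)"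
proof -
  let ?d = "\<lambda>t. ennreal (normal_density 0 (1 / sqrt 2) t)"
  let ?f = "\<lambda>c t. ?d t * (if c = b then g t else 1)"
  have "(\<integral>\<^sup>+x. g (x \<bullet> b) \<partial>gauss) = (\<integral>\<^sup>+x. (\<Prod>c\<in>Basis. ?d (x \<bullet> c)) * g (x \<bullet> b) \<partial>(lborel :: 'a measure))"
    unfolding gauss_def
    by (subst nn_integral_density)
       (simp_all add: gauss_density_Basis normal_density_half prod_ennreal)
  also have "\<dots> = (\<integral>\<^sup>+x. (\<Prod>c\<in>Basis. ?f c (x \<bullet> c)) \<partial>(lborel :: 'a measure))"
    using b by (intro nn_integral_cong) (simp add: prod.distrib prod.delta)
  also have "\<dots> = (\<Prod>c\<in>Basis. \<integral>\<^sup>+t. ?f c t \<partial>lborel)"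
    by (rule nn_integral_lborel_prod) auto
  also have "\<dots> = (\<Prod>c\<in>Basis. if c = b then \<integral>\<^sup>+t. ?d t * g t \<partial>lborel else 1)"
  proof (intro prod.cong refl)
    fix c :: 'a
    have "(\<integral>\<^sup>+t. ?d t \<partial>lborel) = 1"
      using prob_space.emeasure_space_1[OF prob_space_normal_density[of "1 / sqrt 2" 0]]
      by (simp add: emeasure_density)
    then show "(\<integral>\<^sup>+t. ?f c t \<partial>lborel) = (if c = b then \<integral>\<^sup>+t. ?d t * g t \<partial>lborel else 1)"
      by simp
  qed
  also have "\<dots> = (\<integral>\<^sup>+t. ?d t * g t \<partial>lborel)"
    using b by (simp add: prod.delta)
  finally show ?thesis .
qed

lemma prob_space_gauss: "prob_space (gauss :: 'a::euclidean_space measure)"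
proof
  obtain b where b: "b \<in> (Basis :: 'a set)" using nonempty_Basis by blast
  have "emeasure (gauss :: 'a measure) (space gauss) = (\<integral>\<^sup>+x. (\<lambda>_. 1) ((x :: 'a) \<bullet> b) \<partial>gauss)"
    by simp
  also have "\<dots> = 1"
    using prob_space.emeasure_space_1[OF prob_space_normal_density[of "1 / sqrt 2" 0]]
    by (subst nn_integral_gauss_Basis[OF b]) (simp_all add: emeasure_density)
  finally show "emeasure (gauss :: 'a measure) (space gauss) = 1" .
qed

text \<open>Apart from normalisation these are the only explicit integrals. The value
  \<open>1 / sqrt pi\<close> is the mean absolute value s * sqrt (2 / pi) of a centred normal
  variable at standard deviation s = 1 / sqrt 2.\<close>

lemma gauss_Basis_moments:
  fixes b :: "'a::euclidean_space"
  assumes b: "b \<in> Basis"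
  shows "has_bochner_integral gauss (\<lambda>x. \<bar>x \<bullet> b\<bar>) (1 / sqrt pi)"
    and "has_bochner_integral gauss (\<lambda>x. (x \<bullet> b)\<^sup>2) (1 / 2)"
proof -
  have *: "has_bochner_integral gauss (\<lambda>x. f (x \<bullet> b)) r"
    if f [measurable]: "f \<in> borel_measurable borel" and nn: "\<And>t. 0 \<le> f t"
      and I: "has_bochner_integral lborel (\<lambda>t. normal_density 0 (1 / sqrt 2) t * f t) r" for f r
  proof (rule has_bochner_integral_nn_integral)
    have "(\<integral>\<^sup>+x. ennreal (f (x \<bullet> b)) \<partial>gauss) = (\<integral>\<^sup>+t. ennreal (normal_density 0 (1 / sqrt 2) t * f t) \<partial>lborel)"
      by (subst nn_integral_gauss_Basis[OF b]) (simp_all add: ennreal_mult nn)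
    also have "\<dots> = ennreal r"
      using I nn by (simp add: has_bochner_integral_iff nn_integral_eq_integral)
    finally show "(\<integral>\<^sup>+x. ennreal (f (x \<bullet> b)) \<partial>gauss) = ennreal r" .
    show "0 \<le> r"
      using I nn by (auto simp: has_bochner_integral_iff intro!: integral_nonneg_AE)
  qed (use nn in auto)
  have "has_bochner_integral lborel (\<lambda>t. normal_density 0 (1 / sqrt 2) t * \<bar>t\<bar>) (1 / sqrt pi)"
    using normal_moment_abs_odd[of "1 / sqrt 2" 0 0] by (simp add: real_sqrt_divide)
  then show "has_bochner_integral gauss (\<lambda>x. \<bar>x \<bullet> b\<bar>) (1 / sqrt pi)"
    by (intro *) auto
  have "has_bochner_integral lborel (\<lambda>t. normal_density 0 (1 / sqrt 2) t * t\<^sup>2) (1 / 2)"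
    using normal_moment_even[of "1 / sqrt 2" 0 1] by (simp add: power_divide)
  then show "has_bochner_integral gauss (\<lambda>x. (x \<bullet> b)\<^sup>2) (1 / 2)"
    by (intro *) auto
qed

text \<open>The image measure is translation invariant, hence by Fubini a multiple of Lebesgue measure;
  the unit ball, which is preserved, shows that the factor is 1.\<close>
lemma distr_lborel_orthogonal:
  fixes T :: "'a::euclidean_space \<Rightarrow> 'a"
  assumes T: "orthogonal_transformation T"
  shows "distr lborel borel T = lborel"
proof (rule measure_eqI)
  let ?M = "distr lborel borel T"
  have T_lin: "linear T" using T by (rule orthogonal_transformation_linear)
  have T_meas [measurable]: "T \<in> borel_measurable borel"
    by (intro borel_measurable_continuous_onI linear_continuous_on linear_conv_bounded_linear[THEN iffD1] T_lin)
  have surj: "surj T" by (rule orthogonal_transformation_surj[OF T])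
  have transl: "(\<integral>\<^sup>+x. f (x + c) \<partial>lborel) = (\<integral>\<^sup>+x. f x \<partial>lborel)"
    if [measurable]: "f \<in> borel_measurable borel" for f :: "'a \<Rightarrow> ennreal" and c
  proof -
    have "lborel = distr lborel borel (\<lambda>x. c + x)" by (rule lborel_distr_plus[symmetric])
    then have "(\<integral>\<^sup>+x. f x \<partial>lborel) = (\<integral>\<^sup>+x. f x \<partial>distr lborel borel (\<lambda>x. c + x))" by simp
    also have "\<dots> = (\<integral>\<^sup>+x. f (c + x) \<partial>lborel)" by (rule nn_integral_distr) auto
    finally show ?thesis by (simp add: add.commute)
  qed
  have translM: "(\<integral>\<^sup>+x. f (T x + c) \<partial>lborel) = (\<integral>\<^sup>+x. f (T x) \<partial>lborel)"
    if [measurable]: "f \<in> borel_measurable borel" for f :: "'a \<Rightarrow> ennreal" and c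
  proof -
    \<comment> \<open>As \<open>T\<close> is onto and linear, shifting its value by \<open>c\<close>
      amounts to shifting its argument by a preimage of \<open>c\<close>.\<close>
    obtain d where "c = T d" using surj by (metis surjD)
    then show ?thesis
      using transl[of "\<lambda>x. f (T x)" d] by (simp add: linear_add[OF T_lin])
  qed
  fix B assume "B \<in> sets ?M"
  then have B [measurable]: "B \<in> sets borel" by simp
  let ?A = "ball 0 1 :: 'a set"
  let ?i = "\<lambda>S. indicator S :: 'a \<Rightarrow> ennreal"
  have [measurable]: "?A \<in> sets borel" by simp
  have TA: "T x \<in> ?A \<longleftrightarrow> x \<in> ?A" and mA: "- x \<in> ?A \<longleftrightarrow> x \<in> ?A" for x
    using T by (simp_all add: orthogonal_transformation)
  have M_B: "emeasure ?M B = (\<integral>\<^sup>+y. ?i B (T y) \<partial>lborel)"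
    by (subst nn_integral_distr[symmetric, where M' = borel]) auto
  \<comment> \<open>The double integral of 1_A(x) 1_B(T y + x) is evaluated twice: directly it gives
    the image measure of \<open>B\<close>, and after replacing x by x - T y and integrating over y
    it gives the Lebesgue measure of \<open>B\<close>, each times the volume of the ball.\<close>
  have "emeasure lborel ?A * emeasure ?M B = (\<integral>\<^sup>+x. ?i ?A x * (\<integral>\<^sup>+y. ?i B (T y) \<partial>lborel) \<partial>lborel)"
    by (subst nn_integral_multc) (auto simp: M_B)
  also have "\<dots> = (\<integral>\<^sup>+x. \<integral>\<^sup>+y. ?i ?A x * ?i B (T y + x) \<partial>lborel \<partial>lborel)"
    by (rule nn_integral_cong) (simp add: nn_integral_cmult translM[of "?i B"])
  also have "\<dots> = (\<integral>\<^sup>+y. \<integral>\<^sup>+x. ?i ?A x * ?i B (T y + x) \<partial>lborel \<partial>lborel)"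
    by (rule lborel_pair.Fubini') simp
  also have "\<dots> = (\<integral>\<^sup>+y. \<integral>\<^sup>+x. ?i ?A (x - T y) * ?i B x \<partial>lborel \<partial>lborel)"
  proof (rule nn_integral_cong)
    fix y
    show "(\<integral>\<^sup>+x. ?i ?A x * ?i B (T y + x) \<partial>lborel) = (\<integral>\<^sup>+x. ?i ?A (x - T y) * ?i B x \<partial>lborel)"
      using transl[of "\<lambda>x. ?i ?A (x - T y) * ?i B x" "T y"] by (simp add: add.commute)
  qed
  also have "\<dots> = (\<integral>\<^sup>+x. \<integral>\<^sup>+y. ?i ?A (x - T y) * ?i B x \<partial>lborel \<partial>lborel)"
    by (rule lborel_pair.Fubini') simp
  also have "\<dots> = (\<integral>\<^sup>+x. emeasure lborel ?A * ?i B x \<partial>lborel)"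
  proof (rule nn_integral_cong)
    fix x
    \<comment> \<open>Symmetry of the ball about the origin turns the difference into a translate of
      \<open>T y\<close>, to which \<open>translM\<close> applies.\<close>
    have "?i ?A (x - T y) = ?i ?A (T y + - x)" for y
      using mA[of "x - T y"] by (simp add: indicator_def)
    then have "(\<integral>\<^sup>+y. ?i ?A (x - T y) \<partial>lborel) = (\<integral>\<^sup>+y. ?i ?A (T y) \<partial>lborel)"
      using translM[of "?i ?A" "- x"] by simp
    also have "\<dots> = emeasure lborel ?A"
      using TA by (simp add: indicator_def nn_integral_indicator[symmetric] del: nn_integral_indicator)
    finally show "(\<integral>\<^sup>+y. ?i ?A (x - T y) * ?i B x \<partial>lborel) = emeasure lborel ?A * ?i B x"
      by (simp add: nn_integral_multc)
  qed
  also have "\<dots> = emeasure lborel ?A * emeasure lborel B"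
    by (simp add: nn_integral_cmult)
  finally have eq: "emeasure lborel ?A * emeasure ?M B = emeasure lborel ?A * emeasure lborel B" .
  have "emeasure lborel ?A \<noteq> 0" "emeasure lborel ?A \<noteq> \<infinity>"
    using content_ball_pos[of 1 "0::'a"] emeasure_lborel_ball_finite[of "0::'a" 1]
    by (auto simp: measure_def)
  with eq show "emeasure ?M B = emeasure lborel B"
    by (simp add: ennreal_mult_cancel_left)
qed simp

text \<open>The density depends on the norm only and Lebesgue measure is preserved, so
  \<open>gauss\<close> is its own image under \<open>T\<close>.\<close>

lemma has_bochner_integral_gauss_orthogonal:
  fixes T :: "'a::euclidean_space \<Rightarrow> 'a" and f :: "'a \<Rightarrow> 'b::{second_countable_topology, banach}"
  assumes T: "orthogonal_transformation T" and f: "has_bochner_integral gauss f I"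
  shows "has_bochner_integral gauss (\<lambda>x. f (T x)) I"
proof -
  have T_meas [measurable]: "T \<in> borel_measurable borel"
    by (intro borel_measurable_continuous_onI linear_continuous_on linear_conv_bounded_linear[THEN iffD1]
        orthogonal_transformation_linear T)
  have "(gauss :: 'a measure) = density (distr lborel borel T) (\<lambda>x. ennreal (exp (- (norm x)\<^sup>2) / sqrt pi ^ DIM('a)))"
    by (simp add: gauss_def distr_lborel_orthogonal[OF T])
  also have "\<dots> = distr (density lborel (\<lambda>x. ennreal (exp (- (norm (T x))\<^sup>2) / sqrt pi ^ DIM('a)))) borel T"
    by (rule density_distr) auto
  also have "\<dots> = distr gauss borel T"
    using T by (simp add: gauss_def orthogonal_transformation)
  finally have eq: "distr gauss borel T = (gauss :: 'a measure)" by simp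
  have fm [measurable]: "f \<in> borel_measurable borel"
    using f by (auto simp: has_bochner_integral_iff dest: borel_measurable_integrable)
  have "has_bochner_integral (distr gauss borel T) f I"
    using f eq by simp
  then show ?thesis
    using integrable_distr_eq[of T gauss borel f] integral_distr[of T gauss borel f]
    by (simp add: has_bochner_integral_iff)
qed

section \<open>Reflections and moments of sign functions\<close>

text \<open>Reflection in the hyperplane orthogonal to \<open>w\<close>. For \<open>w = 0\<close>
  division by zero makes it the identity, which is still orthogonal, so its uses need no side
  condition.\<close>

definition householder :: "'a::real_inner \<Rightarrow> 'a \<Rightarrow> 'a" where
  "householder w x = x - (2 * (x \<bullet> w) / (w \<bullet> w)) *\<^sub>R w"

lemma householder_inner: "householder w x \<bullet> y = x \<bullet> householder w y"
  by (simp add: householder_def inner_diff_left inner_diff_right inner_commute)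

lemma householder_involution: "householder w (householder w x) = x"
  by (cases "w = 0")
     (simp_all add: householder_def inner_diff_left algebra_simps divide_simps flip: scaleR_add_left)

lemma orthogonal_transformation_householder: "orthogonal_transformation (householder w)"
proof -
  have "linear (householder w)"
    by (rule linearI)
       (simp_all add: householder_def inner_add_left algebra_simps add_divide_distrib)
  then show ?thesis
    by (simp add: orthogonal_transformation_def householder_inner householder_involution)
qed

text \<open>For equal norms the hyperplane orthogonal to \<open>u - v\<close> is the perpendicular
  bisector of \<open>u\<close> and \<open>v\<close>.\<close>

lemma householder_swap:
  assumes "norm u = norm v"
  shows "householder (u - v) u = v"
proof (cases "u = v")
  case False
  have "(u - v) \<bullet> (u - v) = 2 * (u \<bullet> (u - v))"
    using assms by (simp add: norm_eq_sqrt_inner inner_diff_left inner_diff_right inner_commute)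
  moreover have "(u - v) \<bullet> (u - v) \<noteq> 0" using False by simp
  ultimately show ?thesis by (simp add: householder_def)
qed (simp add: householder_def)

text \<open>A reflection carries a multiple of a basis vector to \<open>u\<close>; being
  self-adjoint, it can be moved onto \<open>x\<close>, where the measure absorbs it.\<close>

lemma gauss_abs_moment:
    "has_bochner_integral gauss (\<lambda>x. \<bar>x \<bullet> u\<bar>) (norm u / sqrt pi)" (is ?abs)
  and gauss_square_moment:
    "has_bochner_integral gauss (\<lambda>x. (x \<bullet> u)\<^sup>2) ((norm u)\<^sup>2 / 2)" (is ?sq)
  for u :: "'a::euclidean_space"
proof -
  obtain b where b: "b \<in> (Basis :: 'a set)" using nonempty_Basis by blast
  define H where "H = householder (norm u *\<^sub>R b - u)"
  have "H (norm u *\<^sub>R b) = u"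
    using b unfolding H_def by (intro householder_swap) simp
  then have H: "H x \<bullet> (norm u *\<^sub>R b) = x \<bullet> u" for x
    by (metis H_def householder_inner)
  have ot: "orthogonal_transformation H"
    by (simp add: H_def orthogonal_transformation_householder)
  have "has_bochner_integral gauss (\<lambda>x. norm u * \<bar>x \<bullet> b\<bar>) (norm u * (1 / sqrt pi))"
    by (intro has_bochner_integral_mult_right gauss_Basis_moments b)
  from has_bochner_integral_gauss_orthogonal[OF ot this]
  moreover have "norm u * \<bar>H x \<bullet> b\<bar> = \<bar>x \<bullet> u\<bar>" for x
    using arg_cong[OF H[of x], of abs] by (simp add: abs_mult)
  ultimately show ?abs by simp
  have "has_bochner_integral gauss (\<lambda>x. (norm u)\<^sup>2 * (x \<bullet> b)\<^sup>2) ((norm u)\<^sup>2 * (1 / 2))"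
    by (intro has_bochner_integral_mult_right gauss_Basis_moments b)
  from has_bochner_integral_gauss_orthogonal[OF ot this]
  moreover have "(norm u)\<^sup>2 * (H x \<bullet> b)\<^sup>2 = (x \<bullet> u)\<^sup>2" for x
    using arg_cong[OF H[of x], of "\<lambda>t. t\<^sup>2"] by (simp add: power_mult_distrib)
  ultimately show ?sq by simp
qed

text \<open>Polarisation of the square moment.\<close>

lemma gauss_covariance:
  fixes u v :: "'a::euclidean_space"
  shows "has_bochner_integral gauss (\<lambda>x. (x \<bullet> u) * (x \<bullet> v)) (u \<bullet> v / 2)"
proof -
  have "has_bochner_integral gauss (\<lambda>x. (1 / 4) * ((x \<bullet> (u + v))\<^sup>2 - (x \<bullet> (u - v))\<^sup>2))
      ((1 / 4) * ((norm (u + v))\<^sup>2 / 2 - (norm (u - v))\<^sup>2 / 2))"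
    by (intro has_bochner_integral_mult_right has_bochner_integral_diff gauss_square_moment)
  moreover have "(1 / 4) * ((x \<bullet> (u + v))\<^sup>2 - (x \<bullet> (u - v))\<^sup>2) = (x \<bullet> u) * (x \<bullet> v)" for x
    by (simp add: inner_diff_right inner_add_right power2_eq_square algebra_simps)
  moreover have "(1 / 4) * ((norm (u + v))\<^sup>2 / 2 - (norm (u - v))\<^sup>2 / 2) = u \<bullet> v / 2"
    by (simp add: power2_norm_eq_inner inner_diff_right inner_diff_left inner_add_right inner_add_left
        inner_commute field_simps)
  ultimately show ?thesis by (simp only:)
qed

text \<open>Hyperplanes are Lebesgue null sets. This lets every sign be treated as 1 or -1 although
  \<open>sgn 0 = 0\<close>.\<close>

lemma AE_gauss_inner_nonzero:
  fixes u :: "'a::euclidean_space"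
  assumes "u \<noteq> 0"
  shows "AE x in gauss. x \<bullet> u \<noteq> 0"
proof -
  have "negligible {x. u \<bullet> x = 0}"
    using assms by (intro negligible_hyperplane) simp
  moreover have "{x. u \<bullet> x = 0} \<in> sets borel"
    by (intro borel_closed closed_hyperplane)
  ultimately have "{x. u \<bullet> x = 0} \<in> null_sets lborel"
    by (simp add: negligible_iff_null_sets null_sets_completion_iff)
  then have "AE x in lborel. u \<bullet> x \<noteq> 0"
    by (rule AE_I') simp
  then show ?thesis
    unfolding gauss_def by (subst AE_density) (auto simp: inner_commute)
qed

lemma integrable_gauss_bounded:
  fixes f :: "'a::euclidean_space \<Rightarrow> real"
  assumes "f \<in> borel_measurable borel" "\<And>x. \<bar>f x\<bar> \<le> B"
  shows "integrable gauss f"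
proof -
  interpret prob_space "gauss :: 'a measure" by (rule prob_space_gauss)
  show ?thesis using assms by (intro integrable_const_bound[of _ B]) auto
qed

lemma gauss_sgn_moment:
  fixes u v :: "'a::euclidean_space"
  assumes u: "u \<noteq> 0"
  shows "has_bochner_integral gauss (\<lambda>x. sgn (x \<bullet> u) * (x \<bullet> v)) (u \<bullet> v / (norm u * sqrt pi))"
proof -
  define c where "c = u \<bullet> v / (u \<bullet> u)"
  define w where "w = v - c *\<^sub>R u"
  have uw: "u \<bullet> w = 0" using u by (simp add: w_def c_def inner_diff_right)
  have int: "integrable gauss (\<lambda>x. sgn (x \<bullet> u) * (x \<bullet> w))"
    by (rule Bochner_Integration.integrable_bound[OF gauss_abs_moment[of w, THEN has_bochner_integral_iff[THEN iffD1, THEN conjunct1]]])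
       (auto simp: abs_mult abs_sgn_eq)
  define I where "I = (LINT x|gauss. sgn (x \<bullet> u) * (x \<bullet> w))"
  have hI: "has_bochner_integral gauss (\<lambda>x. sgn (x \<bullet> u) * (x \<bullet> w)) I"
    using int by (simp add: I_def has_bochner_integral_iff)
  \<comment> \<open>The reflection fixes \<open>u\<close> and negates \<open>w\<close>, so it flips
    the sign of the integrand but keeps the integral, which must then be 0.\<close>
  have "householder w u = u" by (simp add: householder_def uw)
  moreover have "householder w w = - w" by (cases "w = 0") (simp_all add: householder_def scaleR_2)
  ultimately have "has_bochner_integral gauss (\<lambda>x. - (sgn (x \<bullet> u) * (x \<bullet> w))) I"
    using has_bochner_integral_gauss_orthogonal[OF orthogonal_transformation_householder[of w] hI]
    by (simp add: householder_inner)
  then have "- I = I"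
    using has_bochner_integral_minus[OF hI] has_bochner_integral_eq by blast
  then have hw: "has_bochner_integral gauss (\<lambda>x. sgn (x \<bullet> u) * (x \<bullet> w)) 0"
    using hI by simp
  have "has_bochner_integral gauss (\<lambda>x. c * \<bar>x \<bullet> u\<bar> + sgn (x \<bullet> u) * (x \<bullet> w)) (c * (norm u / sqrt pi) + 0)"
    by (intro has_bochner_integral_add has_bochner_integral_mult_right gauss_abs_moment hw)
  moreover have "c * \<bar>x \<bullet> u\<bar> + sgn (x \<bullet> u) * (x \<bullet> w) = sgn (x \<bullet> u) * (x \<bullet> v)" for x
    by (simp add: w_def inner_diff_right algebra_simps abs_sgn[of "x \<bullet> u"])
  moreover have "c * (norm u / sqrt pi) + 0 = u \<bullet> v / (norm u * sqrt pi)"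
    using u by (simp add: c_def dot_square_norm power2_eq_square)
  ultimately show ?thesis by simp
qed

section \<open>The arcsine law for signs of linear functionals\<close>

lemma sgn_between:
  fixes x y z :: real
  assumes "p * z + q * x = r * y" "p > 0" "q > 0" "r \<ge> 0" "x \<noteq> 0" "y \<noteq> 0" "z \<noteq> 0"
  shows "sgn x * sgn y + sgn y * sgn z = 1 + sgn x * sgn z"
proof -
  \<comment> \<open>If \<open>x\<close> and \<open>z\<close> have the same sign, the positive
    combination forces it on \<open>y\<close>. If they differ, the nonzero \<open>y\<close> agrees
    with exactly one of them and both sides are 0. Since 1 - sgn a * sgn b is twice the indicator of
    a sign change, the claim says that sign changes add up.\<close>
  consider "x > 0" "z > 0" | "x < 0" "z < 0" | "sgn x = - sgn z"
    using assms by (cases "x > 0"; cases "z > 0") (auto simp: not_less order_le_less)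
  then show ?thesis
  proof cases
    case 1
    then have "r * y > 0" using assms by (metis add_pos_pos mult_pos_pos)
    with \<open>r \<ge> 0\<close> have "y > 0" by (simp add: zero_less_mult_iff)
    with 1 show ?thesis by simp
  next
    case 2
    then have "r * y < 0" using assms by (metis add_neg_neg mult_pos_neg)
    with \<open>r \<ge> 0\<close> have "y < 0" by (simp add: mult_less_0_iff)
    with 2 show ?thesis by simp
  next
    case 3
    with assms show ?thesis by (auto simp: sgn_if split: if_splits)
  qed
qed

text \<open>A bounded solution of Cauchy's functional equation that vanishes at the right end point is
  zero, because reflecting into the left half and doubling improves any bound by a factor 2.\<close>
lemma bounded_additive_on_interval_eq_0:
  fixes g :: "real \<Rightarrow> real"
  assumes add: "\<And>s t. 0 \<le> s \<Longrightarrow> 0 \<le> t \<Longrightarrow> s + t \<le> a \<Longrightarrow> g (s + t) = g s + g t"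
    and bnd: "\<And>t. 0 \<le> t \<Longrightarrow> t \<le> a \<Longrightarrow> \<bar>g t\<bar> \<le> B"
    and end0: "g a = 0"
    and t: "0 \<le> t" "t \<le> a"
  shows "g t = 0"
proof -
  have *: "\<bar>g t\<bar> \<le> B / 2 ^ k" if "0 \<le> t" "t \<le> a" for t k
    using that
  proof (induction k arbitrary: t)
    case (Suc k)
    have half: "\<bar>g s\<bar> \<le> B / 2 ^ Suc k" if "0 \<le> s" "2 * s \<le> a" for s
      using Suc.IH[of "2 * s"] add[of s s] that by (simp add: mult_2[symmetric])
    show ?case
    proof (cases "2 * t \<le> a")
      case False
      have "g t = - g (a - t)"
        using add[of t "a - t"] Suc.prems end0 by simp
      then show ?thesis using half[of "a - t"] False Suc.prems by simp
    qed (use half Suc.prems in auto)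
  qed (use bnd in auto)
  have "(\<lambda>k. B / 2 ^ k) \<longlonglongrightarrow> 0"
    by real_asymp
  then have "\<bar>g t\<bar> \<le> 0"
    by (rule LIMSEQ_le_const) (use * t in auto)
  then show ?thesis by simp
qed

text \<open>The vectors \<open>w t\<close> run along a half circle, and sign changes between
  successive directions add up. Reflections, together with the symmetry of \<open>D\<close>, do the
  work of rotations.\<close>

lemma gauss_sgn_angle:
  fixes e f :: "'a::euclidean_space"
  assumes e: "norm e = 1" and f: "norm f = 1" and ef: "e \<bullet> f = 0" and t: "0 \<le> t" "t \<le> pi"
  shows "(LINT x|gauss. sgn (x \<bullet> e) * sgn (x \<bullet> (cos t *\<^sub>R e + sin t *\<^sub>R f))) = 1 - 2 * t / pi"
proof -
  interpret prob_space "gauss :: 'a measure" by (rule prob_space_gauss)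
  define w where "w t = cos t *\<^sub>R e + sin t *\<^sub>R f" for t
  define D where "D s t = (LINT x|gauss. sgn (x \<bullet> w s) * sgn (x \<bullet> w t))" for s t
  have [simp]: "e \<bullet> e = 1" "f \<bullet> f = 1" "f \<bullet> e = 0" "e \<bullet> f = 0"
    using e f ef by (simp_all add: norm_eq_1 inner_commute)
  have ww: "w s \<bullet> w t = cos (s - t)" for s t
    by (simp add: w_def inner_add_left inner_add_right cos_diff)
  have w_nz: "w s \<noteq> 0" for s
    using ww[of s s] by auto
  have int: "integrable gauss (\<lambda>x. sgn (x \<bullet> u) * sgn (x \<bullet> v))" for u v :: 'a
    by (rule integrable_gauss_bounded[of _ 1]) (auto simp: abs_mult abs_sgn_eq)
  have D_self: "D s s = 1" for s
  proof -
    have "D s s = (LINT x|(gauss :: 'a measure). 1)"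
      unfolding D_def
      by (rule integral_cong_AE)
         (use AE_gauss_inner_nonzero[OF w_nz[of s]] in \<open>auto simp: sgn_mult[symmetric] sgn_if not_less zero_less_mult_iff\<close>)
    then show ?thesis by (simp add: prob_space[simplified])
  qed
  have D_commute: "D s t = D t s" for s t
    by (simp add: D_def mult.commute)
  have D_refl: "D (c - s) (c - t) = D s t" for c s t
  proof -
    \<comment> \<open>The normal of the line at angle \<open>c / 2\<close>; reflecting in that line
      sends the angle \<open>s\<close> to \<open>c - s\<close>.\<close>
    define m where "m = w (c / 2 + pi / 2)"
    have H: "householder m (w s) = w (c - s)" for s
    proof -
      have "m \<bullet> m = 1" by (simp add: m_def ww)
      moreover have "w s \<bullet> m = sin (s - c / 2)"
        by (simp add: m_def ww cos_diff sin_diff cos_add sin_add)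
      ultimately have "householder m (w s) = w s - (2 * sin (s - c / 2)) *\<^sub>R m"
        by (simp add: householder_def)
      also have "\<dots> = (cos s + 2 * sin (s - c / 2) * sin (c / 2)) *\<^sub>R e
          + (sin s - 2 * sin (s - c / 2) * cos (c / 2)) *\<^sub>R f"
        by (simp add: m_def w_def cos_add sin_add algebra_simps)
      also have "cos s + 2 * sin (s - c / 2) * sin (c / 2) = cos (c - s)"
        using sin_times_sin[of "s - c / 2" "c / 2"] cos_minus[of "c - s"] by simp
      also have "sin s - 2 * sin (s - c / 2) * cos (c / 2) = sin (c - s)"
        using sin_times_cos[of "s - c / 2" "c / 2"] sin_minus[of "c - s"] by simp
      finally show ?thesis by (simp add: w_def)
    qed
    have "has_bochner_integral gauss (\<lambda>x. sgn (x \<bullet> w s) * sgn (x \<bullet> w t)) (D s t)"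
      using int by (simp add: D_def has_bochner_integral_iff)
    from has_bochner_integral_gauss_orthogonal[OF orthogonal_transformation_householder[of m] this]
    show ?thesis
      by (simp add: householder_inner H D_def has_bochner_integral_iff)
  qed
  have D_add: "D 0 s + D 0 t = 1 + D 0 (s + t)" if st: "0 \<le> s" "0 \<le> t" "s + t \<le> pi" for s t
  proof -
    \<comment> \<open>\<open>sgn_between\<close> needs strictly positive weights
      \<open>sin s\<close> and \<open>sin t\<close>, so zero angles are settled by
      \<open>D_self\<close>.\<close>
    consider "s = 0" | "t = 0" | "0 < s" "0 < t" using st by linarith
    then show ?thesis
    proof cases
      case 3
      have AE: "AE x in gauss. sgn (x \<bullet> w 0) * sgn (x \<bullet> w s) + sgn (x \<bullet> w s) * sgn (x \<bullet> w (s + t))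
          = 1 + sgn (x \<bullet> w 0) * sgn (x \<bullet> w (s + t))"
        using AE_gauss_inner_nonzero[OF w_nz[of 0]] AE_gauss_inner_nonzero[OF w_nz[of s]]
          AE_gauss_inner_nonzero[OF w_nz[of "s + t"]]
      proof eventually_elim
        case (elim x)
        \<comment> \<open>The middle direction is a positive combination of the outer two. Its own
          weight \<open>sin (s + t)\<close> vanishes when \<open>s + t = pi\<close>, which
          \<open>sgn_between\<close> allows.\<close>
        have "sin s *\<^sub>R w (s + t) + sin t *\<^sub>R w 0 = sin (s + t) *\<^sub>R w s"
        proof -
          have "sin s * cos (s + t) + sin t = sin (s + t) * cos s"
            using sin_diff[of "s + t" s] by (simp add: mult.commute)
          then show ?thesis
            by (simp add: w_def scaleR_add_right mult.commute flip: scaleR_add_left)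
        qed
        then have "sin s * (x \<bullet> w (s + t)) + sin t * (x \<bullet> w 0) = sin (s + t) * (x \<bullet> w s)"
          by (metis inner_add_right inner_scaleR_right)
        then show ?case
          by (rule sgn_between) (use 3 st elim in \<open>auto intro: sin_gt_zero sin_ge_zero\<close>)
      qed
      have "D 0 s + D s (s + t) = (LINT x|gauss. sgn (x \<bullet> w 0) * sgn (x \<bullet> w s) + sgn (x \<bullet> w s) * sgn (x \<bullet> w (s + t)))"
        by (simp add: D_def int)
      also have "\<dots> = (LINT x|gauss. 1 + sgn (x \<bullet> w 0) * sgn (x \<bullet> w (s + t)))"
        by (rule integral_cong_AE[OF _ _ AE]) auto
      also have "\<dots> = 1 + D 0 (s + t)"
        by (simp add: D_def int prob_space[simplified])
      \<comment> \<open>Reflecting with \<open>c = s + t\<close> takes the angles \<open>s\<close>,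
        \<open>s + t\<close> to \<open>t\<close>, \<open>0\<close>.\<close>
      finally show ?thesis
        using D_refl[of "s + t" s "s + t"] D_commute[of t 0] by simp
    qed (simp_all add: D_self)
  qed
  \<comment> \<open>Subtracting the affine function with the values 1 at 0 and -1 at
    \<open>pi\<close>, which are those of \<open>D 0\<close>, turns \<open>D_add\<close> into
    Cauchy's equation with zero end value. Both terms lie between -1 and 1, hence the bound
    2.\<close>
  define g where "g t = D 0 t - (1 - 2 * t / pi)" for t
  have "g t = 0"
  proof (rule bounded_additive_on_interval_eq_0[where g = g and a = pi and B = 2])
    show "g (s + t) = g s + g t" if "0 \<le> s" "0 \<le> t" "s + t \<le> pi" for s t
      using D_add[OF that] by (simp add: g_def add_divide_distrib algebra_simps)
    show "\<bar>g t\<bar> \<le> 2" if "0 \<le> t" "t \<le> pi" for t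
    proof -
      have "\<bar>D 0 t\<bar> \<le> (LINT x|(gauss :: 'a measure). 1)"
        unfolding D_def
        by (rule order_trans[OF integral_abs_bound integral_mono[OF integrable_abs[OF int]]])
          (auto simp: abs_mult abs_sgn_eq)
      then have "\<bar>D 0 t\<bar> \<le> 1" by (simp add: prob_space[simplified])
      moreover have "0 \<le> 2 * t / pi" "2 * t / pi \<le> 2" using that by (auto simp: divide_simps)
      ultimately show ?thesis unfolding g_def by linarith
    qed
    have "w pi = - w 0" by (simp add: w_def)
    then have "D 0 pi = - D 0 0" by (simp add: D_def)
    then show "g pi = 0" by (simp add: g_def D_self)
  qed (use t in auto)
  then show ?thesis by (simp add: g_def D_def w_def)
qed

text \<open>Only directions matter, so \<open>u\<close> and \<open>v\<close> are normalised; the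
  angle between them is \<open>arccos \<rho>\<close>, and arccos = pi / 2 - arcsin turns the linear
  law in the angle into an arcsine.\<close>

lemma gauss_sgn_sgn:
  fixes u v :: "'a::euclidean_space"
  assumes u: "u \<noteq> 0" and v: "v \<noteq> 0"
  shows "has_bochner_integral gauss (\<lambda>x. sgn (x \<bullet> u) * sgn (x \<bullet> v))
      (2 / pi * arcsin (u \<bullet> v / (norm u * norm v)))"
proof -
  interpret prob_space "gauss :: 'a measure" by (rule prob_space_gauss)
  define e e' where "e = u /\<^sub>R norm u" and "e' = v /\<^sub>R norm v"
  define \<rho> where "\<rho> = e \<bullet> e'"
  have [simp]: "norm e = 1" "norm e' = 1" using u v by (simp_all add: e_def e'_def)
  have [simp]: "e \<bullet> e = 1" "e' \<bullet> e' = 1" by (simp_all flip: norm_eq_1)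
  have rho: "\<rho> = u \<bullet> v / (norm u * norm v)"
    by (simp add: \<rho>_def e_def e'_def divide_simps)
  have abs_rho: "\<bar>\<rho>\<bar> \<le> 1" using Cauchy_Schwarz_ineq2[of e e'] by (simp add: \<rho>_def)
  have int: "integrable gauss (\<lambda>x. sgn (x \<bullet> u) * sgn (x \<bullet> v))"
    by (rule integrable_gauss_bounded[of _ 1]) (auto simp: abs_mult abs_sgn_eq)
  have sgn_eq: "sgn (x \<bullet> u) * sgn (x \<bullet> v) = sgn (x \<bullet> e) * sgn (x \<bullet> e')" for x
    using u v by (simp add: e_def e'_def sgn_mult sgn_divide)
  have "(LINT x|gauss. sgn (x \<bullet> e) * sgn (x \<bullet> e')) = 1 - 2 * arccos \<rho> / pi"
  proof (cases "\<bar>\<rho>\<bar> < 1")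
    case True
    define s where "s = sqrt (1 - \<rho>\<^sup>2)"
    have "\<rho>\<^sup>2 < 1" using True by (simp add: abs_square_less_1)
    then have s: "s > 0" "s\<^sup>2 = 1 - \<rho>\<^sup>2" by (simp_all add: s_def)
    \<comment> \<open>Gram-Schmidt; the normalising factor \<open>s\<close> is the sine of the
      angle.\<close>
    define f where "f = (e' - \<rho> *\<^sub>R e) /\<^sub>R s"
    have "f \<bullet> f = (1 - \<rho>\<^sup>2) / s\<^sup>2"
      using s(1) by (simp add: f_def inner_diff_left inner_diff_right \<rho>_def[symmetric] inner_commute[of e' e]
          power2_eq_square field_simps)
    with s \<open>\<rho>\<^sup>2 < 1\<close> have "norm f = 1" by (simp add: norm_eq_1)
    moreover have "e \<bullet> f = 0" by (simp add: f_def inner_diff_right \<rho>_def)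
    moreover have "cos (arccos \<rho>) *\<^sub>R e + sin (arccos \<rho>) *\<^sub>R f = e'"
      using True s by (simp add: sin_arccos_abs s_def[symmetric] f_def)
    ultimately show ?thesis
      using gauss_sgn_angle[of e f "arccos \<rho>"] True by (simp add: arccos_lbound arccos_ubound)
  next
    case False
    with abs_rho have r: "\<rho> = 1 \<or> \<rho> = -1" by linarith
    \<comment> \<open>In the parallel case Gram-Schmidt has nothing to normalise; instead the
      integrand is almost everywhere the constant \<open>\<rho>\<close>.\<close>
    have "(e' - \<rho> *\<^sub>R e) \<bullet> (e' - \<rho> *\<^sub>R e) = 0"
      using r by (auto simp: inner_diff_left inner_diff_right \<rho>_def[symmetric] inner_commute[of e' e])
    then have e': "e' = \<rho> *\<^sub>R e" by simp
    have "norm e = 1" by simp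
    then have "e \<noteq> 0" by force
    have "(LINT x|gauss. sgn (x \<bullet> e) * sgn (x \<bullet> e')) = (LINT x|(gauss :: 'a measure). \<rho>)"
    proof (rule integral_cong_AE)
      show "AE x in gauss. sgn (x \<bullet> e) * sgn (x \<bullet> e') = \<rho>"
        using AE_gauss_inner_nonzero[OF \<open>e \<noteq> 0\<close>]
        by eventually_elim (use r e' in \<open>auto simp: sgn_if\<close>)
    qed auto
    also have "\<dots> = 1 - 2 * arccos \<rho> / pi"
      using r by (auto simp: prob_space[simplified])
    finally show ?thesis .
  qed
  also have "\<dots> = 2 / pi * arcsin \<rho>"
    using abs_rho by (simp add: arccos_arcsin_eq field_simps)
  finally show ?thesis
    using int by (simp add: has_bochner_integral_iff sgn_eq rho)
qed

section \<open>Circularly symmetric Gaussian vectors\<close>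

lemma has_bochner_integral_Complex:
  assumes "has_bochner_integral M f a" "has_bochner_integral M g b"
  shows "has_bochner_integral M (\<lambda>x. Complex (f x) (g x)) (Complex a b)"
  unfolding Complex_eq
  by (intro has_bochner_integral_add has_bochner_integral_mult_right has_bochner_integral_of_real assms)

text \<open>The four hypotheses express circular symmetry: equal covariances of the real and the
  imaginary parts, opposite mixed ones. Each real product contributes half a component of
  \<open>\<kappa>\<close>, and two of them add up.\<close>

lemma gauss_complex_covariance:
  fixes u v u' v' :: "'a::euclidean_space"
  assumes "u \<bullet> u' = Re \<kappa>" "v \<bullet> v' = Re \<kappa>" "v \<bullet> u' = Im \<kappa>" "u \<bullet> v' = - Im \<kappa>"
  shows "has_bochner_integral gauss (\<lambda>x. Complex (x \<bullet> u) (x \<bullet> v) * cnj (Complex (x \<bullet> u') (x \<bullet> v'))) \<kappa>"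
proof -
  have "has_bochner_integral gauss
     (\<lambda>x. Complex ((x \<bullet> u) * (x \<bullet> u') + (x \<bullet> v) * (x \<bullet> v')) ((x \<bullet> v) * (x \<bullet> u') - (x \<bullet> u) * (x \<bullet> v')))
     (Complex (Re \<kappa> / 2 + Re \<kappa> / 2) (Im \<kappa> / 2 - (- Im \<kappa>) / 2))"
    using gauss_covariance[of u u'] gauss_covariance[of v v'] gauss_covariance[of v u'] gauss_covariance[of u v']
    unfolding assms
    by (intro has_bochner_integral_Complex has_bochner_integral_add has_bochner_integral_diff)
  moreover have "Complex ((x \<bullet> u) * (x \<bullet> u') + (x \<bullet> v) * (x \<bullet> v')) ((x \<bullet> v) * (x \<bullet> u') - (x \<bullet> u) * (x \<bullet> v'))
      = Complex (x \<bullet> u) (x \<bullet> v) * cnj (Complex (x \<bullet> u') (x \<bullet> v'))" for x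
    by (simp add: complex_eq_iff)
  moreover have "Complex (Re \<kappa> / 2 + Re \<kappa> / 2) (Im \<kappa> / 2 - (- Im \<kappa>) / 2) = \<kappa>"
    by (simp add: complex_eq_iff)
  ultimately show ?thesis by (simp only:)
qed

text \<open>Circular symmetry makes the two sign moments in each component equal, and the common
  norm \<open>\<sigma>\<close> lets both share one factor.\<close>

lemma gauss_complex_Qc_covariance:
  fixes u v u' v' :: "'a::euclidean_space"
  assumes \<kappa>: "u \<bullet> u' = Re \<kappa>" "v \<bullet> v' = Re \<kappa>" "v \<bullet> u' = Im \<kappa>" "u \<bullet> v' = - Im \<kappa>"
    and \<sigma>: "norm u = \<sigma>" "norm v = \<sigma>" "\<sigma> > 0"
  shows "has_bochner_integral gauss (\<lambda>x. Qc (Complex (x \<bullet> u) (x \<bullet> v)) * cnj (Complex (x \<bullet> u') (x \<bullet> v')))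
     (complex_of_real (sqrt (2 / pi) / \<sigma>) * \<kappa>)"
proof -
  have nz: "u \<noteq> 0" "v \<noteq> 0" using \<sigma> by auto
  have "has_bochner_integral gauss
     (\<lambda>x. Complex (1 / sqrt 2 * (sgn (x \<bullet> u) * (x \<bullet> u') + sgn (x \<bullet> v) * (x \<bullet> v')))
                  (1 / sqrt 2 * (sgn (x \<bullet> v) * (x \<bullet> u') - sgn (x \<bullet> u) * (x \<bullet> v'))))
     (Complex (1 / sqrt 2 * (u \<bullet> u' / (norm u * sqrt pi) + v \<bullet> v' / (norm v * sqrt pi)))
              (1 / sqrt 2 * (v \<bullet> u' / (norm v * sqrt pi) - u \<bullet> v' / (norm u * sqrt pi))))"
    by (intro has_bochner_integral_Complex has_bochner_integral_add has_bochner_integral_diff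
        has_bochner_integral_mult_right gauss_sgn_moment nz)
  moreover have "Complex (1 / sqrt 2 * (sgn (x \<bullet> u) * (x \<bullet> u') + sgn (x \<bullet> v) * (x \<bullet> v')))
                  (1 / sqrt 2 * (sgn (x \<bullet> v) * (x \<bullet> u') - sgn (x \<bullet> u) * (x \<bullet> v')))
     = Qc (Complex (x \<bullet> u) (x \<bullet> v)) * cnj (Complex (x \<bullet> u') (x \<bullet> v'))" for x
    by (simp add: Qc_def complex_eq_iff field_simps)
  moreover have "Complex (1 / sqrt 2 * (u \<bullet> u' / (norm u * sqrt pi) + v \<bullet> v' / (norm v * sqrt pi)))
              (1 / sqrt 2 * (v \<bullet> u' / (norm v * sqrt pi) - u \<bullet> v' / (norm u * sqrt pi)))
     = complex_of_real (sqrt (2 / pi) / \<sigma>) * \<kappa>"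
  proof -
    have *: "1 / sqrt 2 * (y / (\<sigma> * sqrt pi) + y / (\<sigma> * sqrt pi)) = sqrt (2 / pi) / \<sigma> * y" for y
      using \<sigma>(3) by (simp add: real_sqrt_divide field_simps)
    show ?thesis
      using *[of "Re \<kappa>"] *[of "Im \<kappa>"] by (simp add: \<kappa> \<sigma> complex_eq_iff)
  qed
  ultimately show ?thesis by (simp only:)
qed

text \<open>Each component is the mean of two equal arcsine terms; in the imaginary part they become
  equal because arcsine is odd.\<close>

lemma gauss_complex_Qc_Qc:
  fixes u v u' v' :: "'a::euclidean_space"
  assumes \<kappa>: "u \<bullet> u' = Re \<kappa>" "v \<bullet> v' = Re \<kappa>" "v \<bullet> u' = Im \<kappa>" "u \<bullet> v' = - Im \<kappa>"
    and \<sigma>: "norm u = \<sigma>" "norm v = \<sigma>" "\<sigma> > 0" and \<sigma>': "norm u' = \<sigma>'" "norm v' = \<sigma>'" "\<sigma>' > 0"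
  shows "has_bochner_integral gauss (\<lambda>x. Qc (Complex (x \<bullet> u) (x \<bullet> v)) * cnj (Qc (Complex (x \<bullet> u') (x \<bullet> v'))))
     (complex_of_real (2 / pi) * Complex (arcsin (Re \<kappa> / (\<sigma> * \<sigma>'))) (arcsin (Im \<kappa> / (\<sigma> * \<sigma>'))))"
proof -
  have nz: "u \<noteq> 0" "v \<noteq> 0" "u' \<noteq> 0" "v' \<noteq> 0" using \<sigma> \<sigma>' by auto
  \<comment> \<open>\<open>arcsin_minus\<close> requires its argument to lie between -1 and
    1.\<close>
  have "\<bar>Im \<kappa>\<bar> \<le> \<sigma> * \<sigma>'"
    using Cauchy_Schwarz_ineq2[of v u'] \<sigma> \<sigma>' \<kappa> by simp
  then have bnd: "\<bar>Im \<kappa> / (\<sigma> * \<sigma>')\<bar> \<le> 1"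
    using \<sigma> \<sigma>' by (simp add: abs_divide abs_mult)
  have "has_bochner_integral gauss
     (\<lambda>x. Complex (1 / 2 * (sgn (x \<bullet> u) * sgn (x \<bullet> u') + sgn (x \<bullet> v) * sgn (x \<bullet> v')))
                  (1 / 2 * (sgn (x \<bullet> v) * sgn (x \<bullet> u') - sgn (x \<bullet> u) * sgn (x \<bullet> v'))))
     (Complex (1 / 2 * (2 / pi * arcsin (u \<bullet> u' / (norm u * norm u')) + 2 / pi * arcsin (v \<bullet> v' / (norm v * norm v'))))
              (1 / 2 * (2 / pi * arcsin (v \<bullet> u' / (norm v * norm u')) - 2 / pi * arcsin (u \<bullet> v' / (norm u * norm v')))))"
    by (intro has_bochner_integral_Complex has_bochner_integral_add has_bochner_integral_diff
        has_bochner_integral_mult_right gauss_sgn_sgn nz)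
  moreover have "Complex (1 / 2 * (sgn (x \<bullet> u) * sgn (x \<bullet> u') + sgn (x \<bullet> v) * sgn (x \<bullet> v')))
                  (1 / 2 * (sgn (x \<bullet> v) * sgn (x \<bullet> u') - sgn (x \<bullet> u) * sgn (x \<bullet> v')))
     = Qc (Complex (x \<bullet> u) (x \<bullet> v)) * cnj (Qc (Complex (x \<bullet> u') (x \<bullet> v')))" for x
    by (simp add: Qc_def complex_eq_iff add_divide_distrib diff_divide_distrib)
  moreover have "Complex (1 / 2 * (2 / pi * arcsin (u \<bullet> u' / (norm u * norm u')) + 2 / pi * arcsin (v \<bullet> v' / (norm v * norm v'))))
              (1 / 2 * (2 / pi * arcsin (v \<bullet> u' / (norm v * norm u')) - 2 / pi * arcsin (u \<bullet> v' / (norm u * norm v'))))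
     = complex_of_real (2 / pi) * Complex (arcsin (Re \<kappa> / (\<sigma> * \<sigma>'))) (arcsin (Im \<kappa> / (\<sigma> * \<sigma>')))"
    using arcsin_minus[of "Im \<kappa> / (\<sigma> * \<sigma>')"] bnd unfolding abs_le_iff
    by (simp add: \<kappa> \<sigma> \<sigma>' complex_eq_iff)
  ultimately show ?thesis by (simp only:)
qed

section \<open>Complex linear forms in a pair of standard Gaussian vectors\<close>

lemma std_cgauss_eq_gauss: "std_cgauss = (gauss :: (complex^'d) measure)"
proof -
  have "(\<Prod>i\<in>UNIV. exp (- (cmod (z $ i))\<^sup>2) / pi) = exp (- (norm z)\<^sup>2) / sqrt pi ^ DIM(complex^'d)" for z :: "complex^'d"
  proof -
    have "(norm z)\<^sup>2 = (\<Sum>i\<in>UNIV. (cmod (z $ i))\<^sup>2)"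
      by (simp add: norm_vec_def L2_set_def sum_nonneg)
    moreover have "sqrt pi ^ DIM(complex^'d) = pi ^ CARD('d)"
      by (simp add: mult.commute[of _ 2] power_mult)
    ultimately show ?thesis
      by (simp add: prod_dividef exp_sum flip: sum_negf)
  qed
  then show ?thesis by (simp add: std_cgauss_def gauss_def)
qed

text \<open>Squared norms add on products. The sources of channel and noise thus become one Gaussian
  vector, to which all moment formulas apply.\<close>

lemma gauss_pair: "gauss \<Otimes>\<^sub>M gauss = (gauss :: ('a::euclidean_space \<times> 'b::euclidean_space) measure)"
proof -
  interpret A: prob_space "gauss :: 'a measure" by (rule prob_space_gauss)
  interpret B: prob_space "gauss :: 'b measure" by (rule prob_space_gauss)
  have "(gauss :: 'a measure) \<Otimes>\<^sub>M (gauss :: 'b measure)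
     = density (lborel \<Otimes>\<^sub>M lborel) (\<lambda>(x, y). ennreal (exp (- (norm x)\<^sup>2) / sqrt pi ^ DIM('a))
          * ennreal (exp (- (norm y)\<^sup>2) / sqrt pi ^ DIM('b)))"
    unfolding gauss_def
    by (rule pair_measure_density)
      (use B.sigma_finite_measure in \<open>auto simp: gauss_def[symmetric] lborel.sigma_finite_measure_axioms\<close>)
  also have "\<dots> = gauss"
    unfolding gauss_def lborel_prod
    by (auto simp: fun_eq_iff norm_Pair power_add exp_add[symmetric] ennreal_mult[symmetric] intro!: arg_cong[where f = "density lborel"])
  finally show ?thesis .
qed

text \<open>Without conjugation, so that \<open>c\<close> can be a row of a block matrix; pairs
  stand for the two column blocks.\<close>

definition clin_form :: "(complex^'n) \<times> (complex^'q) \<Rightarrow> (complex^'n) \<times> (complex^'q) \<Rightarrow> complex" where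
  "clin_form c z = (\<Sum>j\<in>UNIV. fst c $ j * fst z $ j) + (\<Sum>j\<in>UNIV. snd c $ j * snd z $ j)"

definition cinner_pair :: "(complex^'n) \<times> (complex^'q) \<Rightarrow> (complex^'n) \<times> (complex^'q) \<Rightarrow> complex" where
  "cinner_pair c d = (\<Sum>j\<in>UNIV. fst c $ j * cnj (fst d $ j)) + (\<Sum>j\<in>UNIV. snd c $ j * cnj (snd d $ j))"

text \<open>The real inner product of complex vectors is the real part of the Hermitian one, hence
  the conjugates; the imaginary part of a form is the real part of -i times it, hence the factor
  \<open>\<i>\<close> after conjugation.\<close>

lemma clin_form_inner_vectors:
  fixes c d :: "(complex^'n) \<times> (complex^'q)"
  defines "u \<equiv> \<lambda>c::(complex^'n) \<times> (complex^'q). ((\<chi> j. cnj (fst c $ j)), (\<chi> j. cnj (snd c $ j)))"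
    and "v \<equiv> \<lambda>c::(complex^'n) \<times> (complex^'q). ((\<chi> j. \<i> * cnj (fst c $ j)), (\<chi> j. \<i> * cnj (snd c $ j)))"
  shows "clin_form c = (\<lambda>z. Complex (z \<bullet> u c) (z \<bullet> v c))"
    and "u c \<bullet> u d = Re (cinner_pair c d)" "v c \<bullet> v d = Re (cinner_pair c d)"
    and "v c \<bullet> u d = Im (cinner_pair c d)" "u c \<bullet> v d = - Im (cinner_pair c d)"
    and "norm (u c) = sqrt (Re (cinner_pair c c))" "norm (v c) = sqrt (Re (cinner_pair c c))"
  by (auto simp: fun_eq_iff u_def v_def clin_form_def cinner_pair_def inner_vec_def inner_complex_def complex_eq_iff
      norm_eq_sqrt_inner sum.distrib sum_subtractf sum_negf algebra_simps)

lemma gauss_clin_form_covariance: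
  "has_bochner_integral gauss (\<lambda>z. clin_form c z * cnj (clin_form d z)) (cinner_pair c d)"
  unfolding clin_form_inner_vectors(1) by (intro gauss_complex_covariance clin_form_inner_vectors)

lemma gauss_clin_form_Qc_covariance:
  assumes "Re (cinner_pair c c) > 0"
  shows "has_bochner_integral gauss (\<lambda>z. Qc (clin_form c z) * cnj (clin_form d z))
    (complex_of_real (sqrt (2 / pi) / sqrt (Re (cinner_pair c c))) * cinner_pair c d)"
  unfolding clin_form_inner_vectors(1)
  by (intro gauss_complex_Qc_covariance clin_form_inner_vectors) (use assms in simp)

lemma gauss_clin_form_Qc_Qc:
  assumes "Re (cinner_pair c c) > 0" "Re (cinner_pair d d) > 0"
  shows "has_bochner_integral gauss (\<lambda>z. Qc (clin_form c z) * cnj (Qc (clin_form d z)))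
    (complex_of_real (2 / pi) *
      Complex (arcsin (Re (cinner_pair c d) / (sqrt (Re (cinner_pair c c)) * sqrt (Re (cinner_pair d d)))))
              (arcsin (Im (cinner_pair c d) / (sqrt (Re (cinner_pair c c)) * sqrt (Re (cinner_pair d d))))))"
  unfolding clin_form_inner_vectors(1)
  by (intro gauss_complex_Qc_Qc clin_form_inner_vectors) (use assms in simp_all)

section \<open>Mixtures of measures\<close>

text \<open>Induction on the construction of measurable functions; in the limit step a finite sum of
  increasing sequences commutes with the supremum.\<close>

lemma nn_integral_mixture:
  fixes p :: "'k::finite \<Rightarrow> real"
  assumes sets_N: "\<And>k. sets (N k) = sets M" and p: "\<And>k. 0 \<le> p k"
    and mix: "\<And>X. X \<in> sets M \<Longrightarrow> emeasure M X = (\<Sum>k\<in>UNIV. ennreal (p k) * emeasure (N k) X)"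
    and f: "f \<in> borel_measurable M"
  shows "(\<integral>\<^sup>+x. f x \<partial>M) = (\<Sum>k\<in>UNIV. ennreal (p k) * (\<integral>\<^sup>+x. f x \<partial>N k))"
  using f
proof (induction rule: borel_measurable_induct)
  case (cong f g)
  then have "(\<integral>\<^sup>+x. f x \<partial>N k) = (\<integral>\<^sup>+x. g x \<partial>N k)" for k
    using sets_eq_imp_space_eq[OF sets_N[of k]] by (intro nn_integral_cong) auto
  moreover have "(\<integral>\<^sup>+x. f x \<partial>M) = (\<integral>\<^sup>+x. g x \<partial>M)"
    using cong by (intro nn_integral_cong) auto
  ultimately show ?case using cong by simp
next
  case (set A)
  then show ?case by (simp add: mix sets_N)
next
  case (mult u c)
  then have [measurable]: "u \<in> borel_measurable (N k)" for k
    using measurable_cong_sets[OF sets_N refl] by blast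
  from mult show ?case
    by (simp add: nn_integral_cmult sum_distrib_left mult.left_commute)
next
  case (add u v)
  then have [measurable]: "u \<in> borel_measurable (N k)" "v \<in> borel_measurable (N k)" for k
    using measurable_cong_sets[OF sets_N refl] by blast+
  from add show ?case
    by (simp add: nn_integral_add sum.distrib distrib_left)
next
  case (seq U)
  then have [measurable]: "U i \<in> borel_measurable (N k)" for k i
    using measurable_cong_sets[OF sets_N refl] by blast
  have "(\<integral>\<^sup>+x. (SUP i. U i) x \<partial>M) = (SUP i. \<integral>\<^sup>+x. U i x \<partial>M)"
    unfolding SUP_apply using seq by (intro nn_integral_monotone_convergence_SUP) auto
  also have "\<dots> = (SUP i. \<Sum>k\<in>UNIV. ennreal (p k) * (\<integral>\<^sup>+x. U i x \<partial>N k))"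
    using seq by simp
  also have "\<dots> = (\<Sum>k\<in>UNIV. SUP i. ennreal (p k) * (\<integral>\<^sup>+x. U i x \<partial>N k))"
    using seq by (intro ennreal_SUP_sum)
       (auto simp: incseq_def le_fun_def intro!: mult_left_mono nn_integral_mono)
  also have "\<dots> = (\<Sum>k\<in>UNIV. ennreal (p k) * (\<integral>\<^sup>+x. (SUP i. U i) x \<partial>N k))"
    unfolding SUP_apply using seq
    by (simp add: nn_integral_monotone_convergence_SUP SUP_mult_left_ennreal)
  finally show ?case .
qed

text \<open>Positive and negative parts reduce this to the nonnegative case, which also yields
  integrability under the mixture.\<close>

lemma has_bochner_integral_mixture_real:
  fixes p :: "'k::finite \<Rightarrow> real" and f :: "'a \<Rightarrow> real"
  assumes sets_N: "\<And>k. sets (N k) = sets M" and p: "\<And>k. 0 < p k"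
    and mix: "\<And>X. X \<in> sets M \<Longrightarrow> emeasure M X = (\<Sum>k\<in>UNIV. ennreal (p k) * emeasure (N k) X)"
    and f: "\<And>k. has_bochner_integral (N k) f (I k)"
  shows "has_bochner_integral M f (\<Sum>k\<in>UNIV. p k * I k)"
proof -
  have int: "integrable (N k) f" "integral\<^sup>L (N k) f = I k" for k
    using f by (auto simp: has_bochner_integral_iff)
  have fm [measurable]: "f \<in> borel_measurable M"
    using borel_measurable_integrable[OF int(1)] measurable_cong_sets[OF sets_N refl] by blast
  have pos: "has_bochner_integral M (\<lambda>x. max 0 (g x)) (\<Sum>k\<in>UNIV. p k * (LINT x|N k. max 0 (g x)))"
    if g: "\<And>k. integrable (N k) g" and gm [measurable]: "g \<in> borel_measurable M" for g :: "'a \<Rightarrow> real"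
  proof (rule has_bochner_integral_nn_integral)
    have "(\<integral>\<^sup>+x. ennreal (max 0 (g x)) \<partial>M) = (\<Sum>k\<in>UNIV. ennreal (p k) * (\<integral>\<^sup>+x. ennreal (max 0 (g x)) \<partial>N k))"
      by (rule nn_integral_mixture[OF sets_N _ mix]) (auto simp: p less_imp_le)
    also have "\<dots> = (\<Sum>k\<in>UNIV. ennreal (p k * (LINT x|N k. max 0 (g x))))"
      using g by (intro sum.cong refl, subst nn_integral_eq_integral)
        (auto simp: ennreal_mult p less_imp_le integral_nonneg_AE)
    also have "\<dots> = ennreal (\<Sum>k\<in>UNIV. p k * (LINT x|N k. max 0 (g x)))"
      by (rule sum_ennreal) (auto intro!: mult_nonneg_nonneg integral_nonneg_AE less_imp_le[OF p])
    finally show "(\<integral>\<^sup>+x. ennreal (max 0 (g x)) \<partial>M) = ennreal (\<Sum>k\<in>UNIV. p k * (LINT x|N k. max 0 (g x)))" .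
    show "0 \<le> (\<Sum>k\<in>UNIV. p k * (LINT x|N k. max 0 (g x)))"
      by (auto intro!: sum_nonneg mult_nonneg_nonneg integral_nonneg_AE less_imp_le[OF p])
  qed auto
  have split: "max 0 (f x) - max 0 (- f x) = f x" for x by auto
  have "has_bochner_integral M (\<lambda>x. max 0 (f x) - max 0 (- f x))
     ((\<Sum>k\<in>UNIV. p k * (LINT x|N k. max 0 (f x))) - (\<Sum>k\<in>UNIV. p k * (LINT x|N k. max 0 (- f x))))"
    using int(1) by (intro has_bochner_integral_diff pos) auto
  moreover have "I k = (LINT x|N k. max 0 (f x)) - (LINT x|N k. max 0 (- f x))" for k
  proof -
    have "(LINT x|N k. max 0 (f x)) - (LINT x|N k. max 0 (- f x)) = (LINT x|N k. max 0 (f x) - max 0 (- f x))"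
      using int(1)[of k] by (intro Bochner_Integration.integral_diff[symmetric]) auto
    then show ?thesis using int(2)[of k] by (simp add: split)
  qed
  ultimately show ?thesis
    by (simp add: split sum_subtractf[symmetric] right_diff_distrib)
qed

lemma has_bochner_integral_mixture:
  fixes p :: "'k::finite \<Rightarrow> real" and f :: "'a \<Rightarrow> complex"
  assumes sets_N: "\<And>k. sets (N k) = sets M" and p: "\<And>k. 0 < p k"
    and mix: "\<And>X. X \<in> sets M \<Longrightarrow> emeasure M X = (\<Sum>k\<in>UNIV. ennreal (p k) * emeasure (N k) X)"
    and f: "\<And>k. has_bochner_integral (N k) f (I k)"
  shows "has_bochner_integral M f (\<Sum>k\<in>UNIV. p k *\<^sub>R I k)"
proof -
  have "has_bochner_integral M (\<lambda>x. Complex (Re (f x)) (Im (f x)))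
     (Complex (\<Sum>k\<in>UNIV. p k * Re (I k)) (\<Sum>k\<in>UNIV. p k * Im (I k)))"
    by (intro has_bochner_integral_Complex has_bochner_integral_mixture_real[OF sets_N p mix]
        has_bochner_integral_Re has_bochner_integral_Im f)
  moreover have "Complex (\<Sum>k\<in>UNIV. p k * Re (I k)) (\<Sum>k\<in>UNIV. p k * Im (I k)) = (\<Sum>k\<in>UNIV. p k *\<^sub>R I k)"
    by (simp add: complex_eq_iff)
  ultimately show ?thesis by simp
qed

section \<open>Square roots of covariance matrices\<close>

definition qform :: "complex^'d^'d \<Rightarrow> complex^'d \<Rightarrow> real" where
  "qform C x = Re (\<Sum>i\<in>UNIV. cnj (x $ i) * (C *v x) $ i)"

lemma hermitian_psd_iff: "hermitian_psd C \<longleftrightarrow> hermT C = C \<and> (\<forall>x. 0 \<le> qform C x)"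
  by (simp only: hermitian_psd_def qform_def)

lemma hermT_eq_iff: "hermT C = C \<longleftrightarrow> (\<forall>i j. cnj (C $ i $ j) = C $ j $ i)"
  by (auto simp: hermT_def vec_eq_iff)

lemma qform_axis: "qform C (axis i 1) = Re (C $ i $ i)"
  by (simp add: qform_def axis_def matrix_vector_mult_def if_distrib if_distribR cong: if_cong)

text \<open>Expansion of the form along one coordinate; the two mixed terms are conjugate because
  \<open>C\<close> is Hermitian.\<close>

lemma qform_minus_axis:
  assumes "hermT C = C"
  shows "qform C (x - axis i s) = qform C x - 2 * Re (cnj s * (C *v x) $ i) + (cmod s)\<^sup>2 * Re (C $ i $ i)"
proof -
  have C: "cnj (C $ i $ j) = C $ j $ i" for i j using assms by (simp add: hermT_eq_iff)
  have ax: "(C *v axis i s) $ k = C $ k $ i * s" for k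
    by (simp add: axis_def matrix_vector_mult_def if_distrib cong: if_cong)
  have "cnj ((x - axis i s) $ k) * (C *v (x - axis i s)) $ k
     = cnj (x $ k) * (C *v x) $ k - cnj (x $ k) * (C $ k $ i * s)
       - (if k = i then cnj s * (C *v x) $ i else 0) + (if k = i then cnj s * (C $ i $ i * s) else 0)" for k
    by (simp add: matrix_vector_mult_diff_distrib ax algebra_simps) (simp add: axis_def algebra_simps)
  then have "(\<Sum>k\<in>UNIV. cnj ((x - axis i s) $ k) * (C *v (x - axis i s)) $ k)
     = (\<Sum>k\<in>UNIV. cnj (x $ k) * (C *v x) $ k) - (\<Sum>k\<in>UNIV. cnj (x $ k) * (C $ k $ i * s))
        - cnj s * (C *v x) $ i + cnj s * (C $ i $ i * s)"
    by (simp add: sum_subtractf sum.distrib)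
  also have "(\<Sum>k\<in>UNIV. cnj (x $ k) * (C $ k $ i * s)) = cnj (cnj s * (C *v x) $ i)"
    by (simp add: matrix_vector_mult_def C sum_distrib_left sum_distrib_right mult_ac)
  also have "cnj s * (C $ i $ i * s) = of_real ((cmod s)\<^sup>2) * C $ i $ i"
    by (simp add: complex_norm_square mult_ac del: of_real_power)
  finally show ?thesis
    unfolding qform_def by (simp del: complex_cnj_mult complex_cnj_cnj)
qed

text \<open>With a zero diagonal entry the form is affine along the axis \<open>i\<close>, and a
  nonzero slope would drive it below 0.\<close>

lemma psd_zero_diagonal:
  assumes C: "hermitian_psd C" and i: "C $ i $ i = 0"
  shows "C $ i $ j = 0"
proof (rule ccontr)
  assume nz: "C $ i $ j \<noteq> 0"
  \<comment> \<open>Chosen to make the form equal to -1.\<close>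
  define t where "t = (Re (C $ j $ j) + 1) / (2 * (cmod (C $ i $ j))\<^sup>2)"
  have "(C *v axis j 1) $ i = C $ i $ j"
    by (simp add: axis_def matrix_vector_mult_def if_distrib cong: if_cong)
  moreover have "cnj (of_real t * C $ i $ j) * C $ i $ j = of_real (t * (cmod (C $ i $ j))\<^sup>2)"
    by (simp add: of_real_power[symmetric] complex_norm_square mult_ac del: of_real_power)
  ultimately have "qform C (axis j 1 - axis i (of_real t * C $ i $ j))
      = Re (C $ j $ j) - 2 * t * (cmod (C $ i $ j))\<^sup>2"
    using C i by (simp add: qform_minus_axis qform_axis hermitian_psd_iff del: complex_cnj_mult)
  also have "\<dots> = - 1"
    using nz by (simp add: t_def field_simps)
  finally show False
    using C by (metis hermitian_psd_iff neg_0_le_iff_le not_one_le_zero)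
qed

text \<open>Cholesky elimination: subtracting the rank one matrix built from a column with nonzero
  diagonal entry leaves a positive semidefinite matrix with fewer nonzero diagonal entries.\<close>
lemma hermitian_psd_square_root:
  fixes C :: "complex^'d::finite^'d"
  assumes "hermitian_psd C"
  shows "\<exists>L::complex^'d^'d. L ** hermT L = C"
proof -
  \<comment> \<open>The clause on vanishing columns carries the induction: the pivot index has
    diagonal entry 0 in the reduced matrix, so its column in the root is free for the eliminated
    part.\<close>
  have "\<exists>L::complex^'d^'d. L ** hermT L = C \<and> (\<forall>j. C $ j $ j = 0 \<longrightarrow> (\<forall>i. L $ i $ j = 0))"
    using assms
  proof (induction "card {i. C $ i $ i \<noteq> 0}" arbitrary: C rule: less_induct)
    case less
    then have herm: "cnj (C $ i $ j) = C $ j $ i" for i j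
      by (simp add: hermitian_psd_def hermT_eq_iff)
    show ?case
    proof (cases "\<forall>i. C $ i $ i = 0")
      case True
      then have "C = 0"
        using psd_zero_diagonal[OF less.prems] by (simp add: vec_eq_iff)
      then show ?thesis by (intro exI[of _ 0]) (simp add: vec_eq_iff matrix_matrix_mult_def)
    next
      case False
      then obtain i where i: "C $ i $ i \<noteq> 0" by blast
      define d where "d = Re (C $ i $ i)"
      have Cii: "C $ i $ i = of_real d"
        using herm[of i i] by (auto simp: complex_eq_iff d_def)
      have "0 \<le> qform C (axis i 1)"
        using less.prems by (simp add: hermitian_psd_iff)
      then have d: "d > 0"
        using i by (auto simp: Cii qform_axis order_le_less)
      \<comment> \<open>The Schur complement of the pivot, padded with a zero row and
        column.\<close>
      define C' where "C' = (\<chi> k l. C $ k $ l - C $ k $ i * C $ i $ l / of_real d)"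
      have psd': "hermitian_psd C'"
        unfolding hermitian_psd_iff
      proof (intro conjI allI)
        show "hermT C' = C'"
          by (simp add: hermT_eq_iff C'_def herm mult.commute)
        fix x :: "complex^'d"
        let ?b = "(C *v x) $ i"
        have "(C' *v x) $ k = (C *v x) $ k - C $ k $ i / of_real d * ?b" for k
          by (simp add: C'_def matrix_vector_mult_def left_diff_distrib right_diff_distrib sum_subtractf sum_distrib_left mult_ac)
        then have "(\<Sum>k\<in>UNIV. cnj (x $ k) * (C' *v x) $ k)
           = (\<Sum>k\<in>UNIV. cnj (x $ k) * (C *v x) $ k) - (\<Sum>k\<in>UNIV. cnj (x $ k) * C $ k $ i) * ?b / of_real d"
          by (simp add: right_diff_distrib sum_subtractf sum_distrib_left sum_divide_distrib mult_ac)
        also have "(\<Sum>k\<in>UNIV. cnj (x $ k) * C $ k $ i) = cnj ?b"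
          by (simp add: matrix_vector_mult_def herm mult.commute)
        also have "cnj ?b * ?b / of_real d = of_real ((cmod ?b)\<^sup>2 / d)"
          by (simp add: complex_norm_square mult.commute del: of_real_power)
        finally have "qform C' x = qform C x - (cmod ?b)\<^sup>2 / d"
          unfolding qform_def by (metis Re_complex_of_real minus_complex.simps(1))
        \<comment> \<open>Completing the square: the subtracted term is what the form loses when
          coordinate \<open>i\<close> is chosen to minimise it.\<close>
        also have "\<dots> = qform C (x - axis i (?b / of_real d))"
        proof -
          have "Re (cnj (?b / of_real d) * ?b) = (cmod ?b)\<^sup>2 / d"
            by (simp add: cmod_power2 add_divide_distrib) (simp add: power2_eq_square)
          moreover have "(cmod (?b / of_real d))\<^sup>2 * d = (cmod ?b)\<^sup>2 / d"
            using d by (simp add: norm_divide power2_eq_square)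
          ultimately show ?thesis
            using less.prems by (simp add: qform_minus_axis hermitian_psd_iff Cii del: complex_cnj_divide)
        qed
        also have "\<dots> \<ge> 0"
          using less.prems by (simp add: hermitian_psd_iff)
        finally show "0 \<le> qform C' x" .
      qed
      have zero: "C' $ j $ j = 0" if "C $ j $ j = 0" for j
        using psd_zero_diagonal[OF less.prems that] that by (simp add: C'_def)
      have zero_i: "C' $ i $ i = 0" using d by (simp add: C'_def Cii)
      have "{j. C' $ j $ j \<noteq> 0} \<subset> {j. C $ j $ j \<noteq> 0}"
        using zero zero_i i by blast
      then have "card {j. C' $ j $ j \<noteq> 0} < card {j. C $ j $ j \<noteq> 0}"
        by (intro psubset_card_mono) auto
      from less.hyps[OF this psd'] obtain L :: "complex^'d^'d"
        where L: "L ** hermT L = C'" and L0: "\<And>j k. C' $ j $ j = 0 \<Longrightarrow> L $ k $ j = 0"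
        by blast
      define L' where "L' = (\<chi> k j. if j = i then C $ k $ i / of_real (sqrt d) else L $ k $ j)"
      have "L' ** hermT L' = C"
      proof -
        have "(\<Sum>j\<in>UNIV. L' $ k $ j * cnj (L' $ l $ j)) = C $ k $ l" for k l
        proof -
          have "of_real (sqrt d) * of_real (sqrt d) = (of_real d :: complex)"
            using d by (simp flip: of_real_mult)
          then have "L' $ k $ j * cnj (L' $ l $ j) = L $ k $ j * cnj (L $ l $ j)
             + (if j = i then C $ k $ i * C $ i $ l / of_real d else 0)" for j
            using L0[OF zero_i] by (simp add: L'_def herm)
          then have "(\<Sum>j\<in>UNIV. L' $ k $ j * cnj (L' $ l $ j))
             = (\<Sum>j\<in>UNIV. L $ k $ j * cnj (L $ l $ j)) + C $ k $ i * C $ i $ l / of_real d"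
            by (simp add: sum.distrib)
          also have "(\<Sum>j\<in>UNIV. L $ k $ j * cnj (L $ l $ j)) = C' $ k $ l"
            by (simp add: matrix_matrix_mult_def hermT_def flip: L)
          finally show ?thesis by (simp add: C'_def)
        qed
        then show ?thesis by (simp add: vec_eq_iff matrix_matrix_mult_def hermT_def)
      qed
      moreover have "L' $ k $ j = 0" if "C $ j $ j = 0" for j k
        using that i L0[OF zero[OF that]] by (auto simp: L'_def)
      ultimately show ?thesis by blast
    qed
  qed
  then show ?thesis by blast
qed

section \<open>Gaussian mixtures with independent Gaussian noise\<close>

text \<open>Names the choice inside \<open>cgauss\<close>; its entries are known only through the
  defining equation.\<close>

definition cgauss_root :: "complex^'d^'d \<Rightarrow> complex^'d^'d" where
  "cgauss_root C = (SOME L. L ** hermT L = C)"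

lemma cgauss_root: "hermitian_psd C \<Longrightarrow> cgauss_root C ** hermT (cgauss_root C) = C"
  unfolding cgauss_root_def by (rule someI_ex) (rule hermitian_psd_square_root)

lemma cgauss_root_scalar:
  "cgauss_root (mat (of_real (\<eta>\<^sup>2))) ** hermT (cgauss_root (mat (of_real (\<eta>\<^sup>2)))) = (mat (of_real (\<eta>\<^sup>2)) :: complex^'d^'d)"
proof -
  have "mat (of_real \<eta>) ** hermT (mat (of_real \<eta>)) = (mat (of_real (\<eta>\<^sup>2)) :: complex^'d^'d)"
  proof -
    have "(mat (of_real \<eta>) :: complex^'d^'d) $ i $ k * cnj ((mat (of_real \<eta>) :: complex^'d^'d) $ j $ k)
        = (if k = i then if i = j then of_real (\<eta>\<^sup>2) else 0 else 0)" for i j k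
      by (auto simp: mat_def power2_eq_square)
    then show ?thesis
      by (simp add: vec_eq_iff matrix_matrix_mult_def hermT_def) (simp add: mat_def)
  qed
  then show ?thesis unfolding cgauss_root_def by (rule someI)
qed

lemma continuous_on_matrix_vector_mult [continuous_intros]:
  fixes A :: "complex^'n^'m"
  assumes "continuous_on S f"
  shows "continuous_on S (\<lambda>x. A *v f x)"
  unfolding matrix_vector_mult_def using assms
  by (intro continuous_intros continuous_on_vec_lambda continuous_on_component)

lemma borel_measurable_matrix_vector_mult [measurable]:
  fixes A :: "complex^'n^'m"
  shows "(\<lambda>x. A *v x) \<in> borel_measurable borel"
  by (intro borel_measurable_continuous_onI continuous_intros)

lemma cgauss_eq_distr: "cgauss C = distr gauss borel (\<lambda>z. cgauss_root C *v z)"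
  by (simp add: cgauss_def std_cgauss_eq_gauss cgauss_root_def)

lemma sets_cgauss [simp, measurable_cong]: "sets (cgauss C) = sets borel"
  by (simp add: cgauss_def)

lemma prob_space_cgauss: "prob_space (cgauss C)"
  unfolding cgauss_eq_distr by (intro prob_space.prob_space_distr prob_space_gauss) simp

lemma cgauss_pair:
  "cgauss C \<Otimes>\<^sub>M cgauss D = distr gauss borel (\<lambda>z. (cgauss_root C *v fst z, cgauss_root D *v snd z))"
proof -
  interpret prob_space "cgauss D" by (rule prob_space_cgauss)
  have "cgauss C \<Otimes>\<^sub>M cgauss D
     = distr (gauss \<Otimes>\<^sub>M gauss) (borel \<Otimes>\<^sub>M borel) (\<lambda>(x, y). (cgauss_root C *v x, cgauss_root D *v y))"
    unfolding cgauss_eq_distr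
    by (rule pair_measure_distr) (use sigma_finite_measure in \<open>simp_all add: cgauss_eq_distr\<close>)
  then show ?thesis by (simp add: gauss_pair borel_prod case_prod_unfold)
qed

text \<open>By independence the joint law is a product whose first factor is a mixture, hence a
  mixture of products, each the image of one standard Gaussian under a block diagonal linear
  map.\<close>

lemma cgauss_mixture_expectation:
  fixes p :: "'k::finite \<Rightarrow> real" and h :: "'s \<Rightarrow> complex^'n" and n :: "'s \<Rightarrow> complex^'q"
    and F :: "(complex^'n) \<times> (complex^'q) \<Rightarrow> complex"
  assumes P: "prob_space P" and p: "\<And>k. 0 < p k"
    and h_meas: "h \<in> borel_measurable P" and n_meas: "n \<in> borel_measurable P"
    and h_distr: "\<And>X. X \<in> sets borel \<Longrightarrow>
        measure (distr P borel h) X = (\<Sum>k\<in>UNIV. p k * measure (cgauss (C k)) X)"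
    and n_distr: "distr P borel n = cgauss D"
    and indep: "distr P (borel \<Otimes>\<^sub>M borel) (\<lambda>\<omega>. (h \<omega>, n \<omega>)) = distr P borel h \<Otimes>\<^sub>M distr P borel n"
    and F: "F \<in> borel_measurable borel"
    and I: "\<And>k. has_bochner_integral gauss (\<lambda>z. F (cgauss_root (C k) *v fst z, cgauss_root D *v snd z)) (I k)"
  shows "(LINT \<omega>|P. F (h \<omega>, n \<omega>)) = (\<Sum>k\<in>UNIV. p k *\<^sub>R I k)"
proof -
  interpret P: prob_space P by fact
  interpret H: prob_space "distr P borel h" by (rule P.prob_space_distr[OF h_meas])
  interpret D: prob_space "cgauss D" by (rule prob_space_cgauss)
  have hd: "emeasure (distr P borel h) X = (\<Sum>k\<in>UNIV. ennreal (p k) * emeasure (cgauss (C k)) X)"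
    if X: "X \<in> sets borel" for X
  proof -
    have "ennreal (p k) * emeasure (cgauss (C k)) X = ennreal (p k * measure (cgauss (C k)) X)" for k
    proof -
      interpret prob_space "cgauss (C k)" by (rule prob_space_cgauss)
      show ?thesis by (simp add: emeasure_eq_measure ennreal_mult less_imp_le[OF p])
    qed
    then show ?thesis
      using X by (simp add: H.emeasure_eq_measure h_distr less_imp_le[OF p])
  qed
  define N where "N k = cgauss (C k) \<Otimes>\<^sub>M cgauss D" for k
  have J: "has_bochner_integral (distr P borel h \<Otimes>\<^sub>M cgauss D) F (\<Sum>k\<in>UNIV. p k *\<^sub>R I k)"
  proof (rule has_bochner_integral_mixture[where N = N])
    show "sets (N k) = sets (distr P borel h \<Otimes>\<^sub>M cgauss D)" for k
      unfolding N_def by (intro sets_pair_measure_cong) auto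
    show "emeasure (distr P borel h \<Otimes>\<^sub>M cgauss D) X = (\<Sum>k\<in>UNIV. ennreal (p k) * emeasure (N k) X)"
      if X: "X \<in> sets (distr P borel h \<Otimes>\<^sub>M cgauss D)" for X
    proof -
      have "sets (distr P borel h \<Otimes>\<^sub>M cgauss D) = sets (cgauss (C k) \<Otimes>\<^sub>M cgauss D)" for k
        by (intro sets_pair_measure_cong) auto
      with X have Xk: "X \<in> sets (cgauss (C k) \<Otimes>\<^sub>M cgauss D)" for k by simp
      \<comment> \<open>Integrating the measure of the sections carries the mixture of the first
        factor over to the product.\<close>
      have "emeasure (distr P borel h \<Otimes>\<^sub>M cgauss D) X
          = (\<integral>\<^sup>+x. emeasure (cgauss D) (Pair x -` X) \<partial>distr P borel h)"
        by (rule D.emeasure_pair_measure_alt[OF X])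
      also have "\<dots> = (\<Sum>k\<in>UNIV. ennreal (p k) * (\<integral>\<^sup>+x. emeasure (cgauss D) (Pair x -` X) \<partial>cgauss (C k)))"
        by (rule nn_integral_mixture)
          (use X in \<open>auto simp: hd less_imp_le[OF p] D.measurable_emeasure_Pair\<close>)
      also have "\<dots> = (\<Sum>k\<in>UNIV. ennreal (p k) * emeasure (N k) X)"
        by (simp add: N_def D.emeasure_pair_measure_alt[OF Xk])
      finally show ?thesis .
    qed
    show "has_bochner_integral (N k) F (I k)" for k
    proof -
      let ?g = "\<lambda>z. (cgauss_root (C k) *v fst z, cgauss_root D *v snd z)"
      have "?g \<in> borel_measurable borel"
        by (intro borel_measurable_continuous_onI continuous_intros)
      then have g: "?g \<in> borel_measurable gauss" by simp
      show ?thesis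
        unfolding N_def cgauss_pair using I[of k]
        by (simp add: has_bochner_integral_iff integrable_distr_eq[OF g F] integral_distr[OF g F])
    qed
  qed (rule p)
  have hn: "(\<lambda>\<omega>. (h \<omega>, n \<omega>)) \<in> P \<rightarrow>\<^sub>M borel \<Otimes>\<^sub>M borel"
    using h_meas n_meas by simp
  have F': "F \<in> borel_measurable (borel \<Otimes>\<^sub>M borel)"
    using F by (simp add: borel_prod)
  show ?thesis
    using J integral_distr[OF hn F'] by (simp add: indep n_distr has_bochner_integral_iff)
qed

section \<open>Matrix algebra and covariances of matrix rows\<close>

lemma sum_matrix_mult: "(\<Sum>k\<in>S. f k) ** B = (\<Sum>k\<in>S. f k ** (B :: complex^'c^'b))" for f :: "'k \<Rightarrow> complex^'b^'a"
  by (simp add: vec_eq_iff matrix_matrix_mult_def sum_distrib_right) (intro allI sum.swap)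

lemma scaleR_matrix_mult: "(c *\<^sub>R M) ** B = c *\<^sub>R (M ** (B :: complex^'c^'b))" for M :: "complex^'b^'a"
  by (simp add: vec_eq_iff matrix_matrix_mult_def scaleR_sum_right)

lemma hermT_mult: "hermT (X ** Y) = hermT Y ** hermT X"
  by (simp add: hermT_def matrix_matrix_mult_def vec_eq_iff mult.commute)

lemma diag_isqrt_mult: "(diag_isqrt C ** X) $ i $ j = of_real (1 / sqrt (Re (C $ i $ i))) * X $ i $ j"
  and mult_diag_isqrt: "(Y ** diag_isqrt C) $ l $ j = Y $ l $ j * of_real (1 / sqrt (Re (C $ j $ j)))"
proof -
  have "(\<Sum>k\<in>UNIV. diag_isqrt C $ i $ k * X $ k $ j)
      = (\<Sum>k\<in>UNIV. if i = k then of_real (1 / sqrt (Re (C $ i $ i))) * X $ k $ j else 0)"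
    by (intro sum.cong) (auto simp: diag_isqrt_def)
  then show "(diag_isqrt C ** X) $ i $ j = of_real (1 / sqrt (Re (C $ i $ i))) * X $ i $ j"
    by (simp add: matrix_matrix_mult_def)
  have "(\<Sum>k\<in>UNIV. Y $ l $ k * diag_isqrt C $ k $ j)
      = (\<Sum>k\<in>UNIV. if k = j then Y $ l $ k * of_real (1 / sqrt (Re (C $ j $ j))) else 0)"
    by (intro sum.cong) (auto simp: diag_isqrt_def)
  then show "(Y ** diag_isqrt C) $ l $ j = Y $ l $ j * of_real (1 / sqrt (Re (C $ j $ j)))"
    by (simp add: matrix_matrix_mult_def)
qed

lemma clin_form_rows: "clin_form (U $ r, V $ r) z = (U *v fst z + V *v snd z) $ r"
  by (simp add: clin_form_def matrix_vector_mult_def)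

lemma cinner_pair_rows: "cinner_pair (U $ r, V $ r) (U' $ s, V' $ s) = (U ** hermT U' + V ** hermT V') $ r $ s"
  by (simp add: cinner_pair_def matrix_matrix_mult_def hermT_def)

lemma cnj_cinner_pair: "cnj (cinner_pair c d) = cinner_pair d c"
  by (simp add: cinner_pair_def mult.commute)

lemma borel_measurable_cnj [measurable]: "cnj \<in> borel_measurable borel"
  by (intro borel_measurable_continuous_onI continuous_intros)

lemma Qc_measurable [measurable]: "Qc \<in> borel_measurable borel"
proof -
  have eq: "Qc = (\<lambda>x. (of_real (sgn (Re x)) + \<i> * of_real (sgn (Im x))) / of_real (sqrt 2))"
    by (simp add: Qc_def fun_eq_iff Complex_eq)
  show ?thesis unfolding eq by measurable
qed

theorem theorem1:
  fixes P :: "'s measure"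
    and p :: "'k::finite \<Rightarrow> real"
    and C :: "'k \<Rightarrow> complex^'n::finite^'n"
    and a :: "complex^'m::finite"
    and \<eta> :: real
    and h :: "'s \<Rightarrow> complex^'n"
    and n :: "'s \<Rightarrow> complex^('n \<times> 'm)"
  assumes "prob_space P"
    and p_pos: "\<And>k. p k > 0"
    and p_sum: "(\<Sum>k\<in>UNIV. p k) = 1"
    and C_psd: "\<And>k. hermitian_psd (C k)"
    and a_norm: "(norm a)\<^sup>2 = real CARD('m)"
    and eta_pos: "\<eta>\<^sup>2 > 0"
    and h_meas: "h \<in> borel_measurable P"
    and n_meas: "n \<in> borel_measurable P"
    and h_distr: "\<And>X. X \<in> sets borel \<Longrightarrow>
        measure (distr P borel h) X = (\<Sum>k\<in>UNIV. p k * measure (cgauss (C k)) X)"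
    and n_distr: "distr P borel n = cgauss (mat (complex_of_real (\<eta>\<^sup>2)))"
    and indep: "distr P (borel \<Otimes>\<^sub>M borel) (\<lambda>\<omega>. (h \<omega>, n \<omega>)) = distr P borel h \<Otimes>\<^sub>M distr P borel n"
  shows
    "let A = kron_I a;
         y = (\<lambda>\<omega>. A *v h \<omega> + n \<omega>);
         r = (\<lambda>\<omega>. Qv (y \<omega>));
         Cyk = (\<lambda>k. A ** C k ** hermT A + mat (complex_of_real (\<eta>\<^sup>2)));
         Cy = (\<Sum>k\<in>UNIV. p k *\<^sub>R Cyk k);
         Cbar = (\<lambda>k. diag_isqrt (Cyk k) ** Cyk k ** diag_isqrt (Cyk k))
     in mexp P (\<lambda>\<omega>. outer (r \<omega>) (y \<omega>)) ** matrix_inv (mexp P (\<lambda>\<omega>. outer (y \<omega>) (y \<omega>)))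
          = sqrt (2 / pi) *\<^sub>R
              (\<Sum>k\<in>UNIV. p k *\<^sub>R (diag_isqrt (Cyk k) ** Cyk k ** matrix_inv Cy))
      \<and> mexp P (\<lambda>\<omega>. outer (h \<omega>) (r \<omega>))
          = sqrt (2 / pi) *\<^sub>R
              (\<Sum>k\<in>UNIV. p k *\<^sub>R (C k ** hermT A ** diag_isqrt (Cyk k)))
      \<and> mexp P (\<lambda>\<omega>. outer (r \<omega>) (r \<omega>))
          = (2 / pi) *\<^sub>R
              (\<Sum>k\<in>UNIV. p k *\<^sub>R carcsin_entry (Cbar k))"
proof -
  define A :: "complex^'n^('n \<times> 'm)" where "A = kron_I a"
  define D :: "complex^('n \<times> 'm)^('n \<times> 'm)" where "D = mat (complex_of_real (\<eta>\<^sup>2))"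
  define Cyk where "Cyk k = A ** C k ** hermT A + D" for k
  define L where "L k = cgauss_root (C k)" for k
  define R where "R = cgauss_root D"
  define yf where "yf z = A *v fst z + snd z" for z :: "(complex^'n) \<times> (complex^('n \<times> 'm))"
  \<comment> \<open>Rows of the block matrices [L_k, 0] and [A L_k, R], which produce h and y from
    the standard Gaussian pair. The zero is written as a row of a zero matrix so that
    \<open>clin_form_rows\<close> and \<open>cinner_pair_rows\<close> apply.\<close>
  define ch :: "'k \<Rightarrow> 'n \<Rightarrow> (complex^'n) \<times> (complex^('n \<times> 'm))"
    where "ch k i = (L k $ i, (0 :: complex^('n \<times> 'm)^'n) $ i)" for k i
  define cy where "cy k r = ((A ** L k) $ r, R $ r)" for k r
  have L: "L k ** hermT (L k) = C k" for k
    unfolding L_def by (rule cgauss_root[OF C_psd])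
  have R: "R ** hermT R = D"
    unfolding R_def D_def by (rule cgauss_root_scalar)
  have lin_h: "(L k *v fst z) $ i = clin_form (ch k i) z" for k i z
    unfolding ch_def clin_form_rows by simp
  have lin_y: "yf (L k *v fst z, R *v snd z) $ r = clin_form (cy k r) z" for k r z
    unfolding cy_def clin_form_rows by (simp add: yf_def matrix_vector_mul_assoc)
  have cip_hy: "cinner_pair (ch k i) (cy k r) = (C k ** hermT A) $ i $ r" for k i r
    unfolding ch_def cy_def cinner_pair_rows
    by (simp add: hermT_mult matrix_mul_assoc L)
  have cip_yy: "cinner_pair (cy k r) (cy k s) = Cyk k $ r $ s" for k r s
  proof -
    have "(A ** L k) ** hermT (A ** L k) = A ** (L k ** hermT (L k)) ** hermT A"
      by (simp only: hermT_mult matrix_mul_assoc)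
    then show ?thesis unfolding cy_def cinner_pair_rows by (simp add: L R Cyk_def)
  qed
  \<comment> \<open>The row of \<open>R\<close> contributes exactly \<open>\<eta>\<^sup>2\<close>
    and the row of \<open>A ** L k\<close> a squared norm.\<close>
  have pos: "0 < Re (Cyk k $ r $ r)" for k r
  proof -
    have "(R ** hermT R) $ r $ r = of_real (\<eta>\<^sup>2)"
      unfolding R by (simp add: D_def mat_def)
    then have "Re (\<Sum>j\<in>UNIV. R $ r $ j * cnj (R $ r $ j)) = \<eta>\<^sup>2"
      by (simp add: matrix_matrix_mult_def hermT_def del: Re_sum)
    moreover have "0 \<le> Re (\<Sum>j\<in>UNIV. (A ** L k) $ r $ j * cnj ((A ** L k) $ r $ j))"
      by (auto simp: complex_mult_cnj intro!: sum_nonneg)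
    ultimately show ?thesis
      using eta_pos unfolding cip_yy[symmetric] cinner_pair_def cy_def
      by (simp add: add_nonneg_pos del: Re_sum)
  qed
  have yf_meas [measurable]: "(\<lambda>z. yf z $ r) \<in> borel_measurable borel" for r
    unfolding yf_def by (intro borel_measurable_continuous_onI continuous_intros)
  have fst_meas [measurable]:
    "(\<lambda>z. fst z $ i) \<in> borel_measurable (borel :: ((complex^'n) \<times> (complex^('n \<times> 'm))) measure)" for i
    by (intro borel_measurable_continuous_onI continuous_intros)
  have expect: "(LINT \<omega>|P. F (h \<omega>, n \<omega>)) = (\<Sum>k\<in>UNIV. p k *\<^sub>R I k)"
    if "F \<in> borel_measurable borel"
      "\<And>k. has_bochner_integral gauss (\<lambda>z. F (L k *v fst z, R *v snd z)) (I k)" for F :: "_ \<Rightarrow> complex" and I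
    by (rule cgauss_mixture_expectation[OF \<open>prob_space P\<close> p_pos h_meas n_meas h_distr n_distr indep that(1)])
       (use that(2) in \<open>simp_all add: L_def R_def D_def\<close>)
  define y where "y \<omega> = yf (h \<omega>, n \<omega>)" for \<omega>
  have yy: "mexp P (\<lambda>\<omega>. outer (y \<omega>) (y \<omega>)) = (\<Sum>k\<in>UNIV. p k *\<^sub>R Cyk k)"
  proof -
    have "(LINT \<omega>|P. y \<omega> $ i * cnj (y \<omega> $ j)) = (\<Sum>k\<in>UNIV. p k *\<^sub>R Cyk k $ i $ j)" for i j
      unfolding y_def by (rule expect) (simp_all add: lin_y gauss_clin_form_covariance flip: cip_yy)
    then show ?thesis by (simp add: mexp_def outer_def vec_eq_iff)
  qed
  have ry: "mexp P (\<lambda>\<omega>. outer (Qv (y \<omega>)) (y \<omega>)) = sqrt (2 / pi) *\<^sub>R (\<Sum>k\<in>UNIV. p k *\<^sub>R (diag_isqrt (Cyk k) ** Cyk k))"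
  proof -
    have "(LINT \<omega>|P. Qc (y \<omega> $ i) * cnj (y \<omega> $ j))
        = (\<Sum>k\<in>UNIV. p k *\<^sub>R (of_real (sqrt (2 / pi) / sqrt (Re (Cyk k $ i $ i))) * Cyk k $ i $ j))" for i j
      unfolding y_def
    proof (rule expect)
      show "has_bochner_integral gauss (\<lambda>z. Qc (yf (L k *v fst z, R *v snd z) $ i) * cnj (yf (L k *v fst z, R *v snd z) $ j))
          (of_real (sqrt (2 / pi) / sqrt (Re (Cyk k $ i $ i))) * Cyk k $ i $ j)" for k
        unfolding lin_y cip_yy[symmetric] by (rule gauss_clin_form_Qc_covariance) (simp add: cip_yy pos)
    qed simp
    then show ?thesis
      by (simp add: mexp_def outer_def Qv_def vec_eq_iff diag_isqrt_mult scaleR_sum_right)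
         (simp add: scaleR_conv_of_real mult_ac)
  qed
  have hr: "mexp P (\<lambda>\<omega>. outer (h \<omega>) (Qv (y \<omega>))) = sqrt (2 / pi) *\<^sub>R (\<Sum>k\<in>UNIV. p k *\<^sub>R (C k ** hermT A ** diag_isqrt (Cyk k)))"
  proof -
    \<comment> \<open>The entry of h is written through \<open>fst\<close> to present the integrand
      as a function of the pair, as \<open>expect\<close> requires.\<close>
    have "(LINT \<omega>|P. fst (h \<omega>, n \<omega>) $ i * cnj (Qc (y \<omega> $ j)))
        = (\<Sum>k\<in>UNIV. p k *\<^sub>R (of_real (sqrt (2 / pi) / sqrt (Re (Cyk k $ j $ j))) * (C k ** hermT A) $ i $ j))" for i j
      unfolding y_def
    proof (rule expect)
      show "has_bochner_integral gauss (\<lambda>z. fst (L k *v fst z, R *v snd z) $ i * cnj (Qc (yf (L k *v fst z, R *v snd z) $ j)))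
          (of_real (sqrt (2 / pi) / sqrt (Re (Cyk k $ j $ j))) * (C k ** hermT A) $ i $ j)" for k
      \<comment> \<open>The moment formula quantises the first factor, so it is applied to the
        conjugated product.\<close>
      proof -
        have "has_bochner_integral gauss (\<lambda>z. cnj (Qc (clin_form (cy k j) z) * cnj (clin_form (ch k i) z)))
           (cnj (of_real (sqrt (2 / pi) / sqrt (Re (cinner_pair (cy k j) (cy k j)))) * cinner_pair (cy k j) (ch k i)))"
          by (rule has_bochner_integral_bounded_linear[OF bounded_linear_cnj gauss_clin_form_Qc_covariance])
             (simp add: cip_yy pos)
        then show ?thesis
          by (simp add: lin_y lin_h cip_yy cnj_cinner_pair cip_hy mult.commute)
      qed
    qed simp
    then show ?thesis
      by (simp add: mexp_def outer_def Qv_def vec_eq_iff mult_diag_isqrt scaleR_sum_right)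
         (simp add: scaleR_conv_of_real mult_ac)
  qed
  have rr: "mexp P (\<lambda>\<omega>. outer (Qv (y \<omega>)) (Qv (y \<omega>)))
      = (2 / pi) *\<^sub>R (\<Sum>k\<in>UNIV. p k *\<^sub>R carcsin_entry (diag_isqrt (Cyk k) ** Cyk k ** diag_isqrt (Cyk k)))"
  proof -
    have entry: "(diag_isqrt (Cyk k) ** Cyk k ** diag_isqrt (Cyk k)) $ i $ j
        = Cyk k $ i $ j / of_real (sqrt (Re (Cyk k $ i $ i)) * sqrt (Re (Cyk k $ j $ j)))" for k i j
      by (simp add: mult_diag_isqrt diag_isqrt_mult)
    have "(LINT \<omega>|P. Qc (y \<omega> $ i) * cnj (Qc (y \<omega> $ j)))
        = (\<Sum>k\<in>UNIV. p k *\<^sub>R (of_real (2 / pi) * carcsin_entry (diag_isqrt (Cyk k) ** Cyk k ** diag_isqrt (Cyk k)) $ i $ j))" for i j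
      unfolding y_def
    proof (rule expect)
      show "has_bochner_integral gauss (\<lambda>z. Qc (yf (L k *v fst z, R *v snd z) $ i) * cnj (Qc (yf (L k *v fst z, R *v snd z) $ j)))
          (of_real (2 / pi) * carcsin_entry (diag_isqrt (Cyk k) ** Cyk k ** diag_isqrt (Cyk k)) $ i $ j)" for k
        using gauss_clin_form_Qc_Qc[of "cy k i" "cy k j"] pos
        by (simp only: lin_y cip_yy carcsin_entry_def vec_lambda_beta entry Re_divide_of_real Im_divide_of_real simp_thms)
    qed simp
    then show ?thesis
      by (simp add: mexp_def outer_def Qv_def vec_eq_iff scaleR_sum_right)
         (simp add: scaleR_conv_of_real mult_ac)
  qed
  have y_eq: "A *v h \<omega> + n \<omega> = y \<omega>" for \<omega>
    by (simp add: y_def yf_def)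
  show ?thesis
    \<comment> \<open>By \<open>yy\<close> the second moment of y is the mixture covariance itself,
      so both sides contain the same \<open>matrix_inv\<close> and only distributing it over the sum
      remains.\<close>
    unfolding Let_def A_def[symmetric] D_def[symmetric] y_eq Cyk_def[symmetric]
    unfolding yy ry hr rr
    by (simp add: scaleR_matrix_mult sum_matrix_mult)
qed

end
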